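(* Let $F:\Omega^X\to\mathbb{R}$ be a bounded random variable, and let $u:\Omega^X\times X\to\mathbb{R}$, $(\omega,x)\mapsto u_x(\omega)$, be a bounded (measurable) random process with compact support in $X$. Then for all $n\geq 0$, $$ E\left[F\left(\int_X u_x(\omega)\,\omega(dx)\right)^n\right] =\sum_{P_1,\ldots,P_k}E\left[\int_{X^k}\varepsilon^+_{\mathfrak{s}_k}\big(F\,u_{s_1}^{|P_1|}\cdots u_{s_k}^{|P_k|}\big)\,\sigma(ds_1)\cdots\sigma(ds_k)\right], $$ where the sum runs over all partitions $P_1\cup\cdots\cup P_k$ of $\{1,\ldots,n\}$ into disjoint non-empty blocks (of any number $k$ of blocks), and $|P_i|$ denotes the cardinality of $P_i$.
   Context: Setting. $X$ is a $\sigma$-compact metric space with Borel $\sigma$-algebra $\mathcal{B}(X)$, and $\sigma$ is a $\sigma$-finite diffuse (non-atomic) measure on $X$, finite on compact sets. The configuration space $\Omega^X$ is the set of at most countable, locally finite subsets $\omega$ of $X$ (finitely many points in each compact set). Each $\omega=\{x_i\}$ is identified with the Radon point measure $\omega=\sum_i\epsilon_{x_i}$, where $\epsilon_x$ is the Dirac measure at $x$; thus $\int_X u_x(\omega)\,\omega(dx)=\sum_{x\in\omega}u_x(\omega)$. $\Omega^X$ carries the $\sigma$-algebra generated by the counting maps $\omega\mapsto\omega(A)$ and the Poisson probability measure $\pi_\sigma$, under which, for all disjoint compact sets $A_1,\ldots,A_m\subset X$, the variables $\omega(A_1),\ldots,\omega(A_m)$ are independent Poisson random variables with respective intensities $\sigma(A_1),\ldots,\sigma(A_m)$.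 $E$ denotes expectation under $\pi_\sigma$. Compact support: $u$ has compact support in $X$ if there is a compact $K\subset X$ with $u_x(\omega)=0$ for all $\omega\in\Omega^X$ and all $x\in X\setminus K$. Addition operator: for $\mathfrak{s}_k=(s_1,\ldots,s_k)\in X^k$ and $G:\Omega^X\to\mathbb{R}$, $\varepsilon^+_{\mathfrak{s}_k}G(\omega)=G(\omega\cup\{s_1,\ldots,s_k\})$. Hence $\varepsilon^+_{\mathfrak{s}_k}(F u_{s_1}^{l_1}\cdots u_{s_k}^{l_k})(\omega)=F(\omega\cup\{s_1,\ldots,s_k\})\prod_{i=1}^k\big(u_{s_i}(\omega\cup\{s_1,\ldots,s_k\})\big)^{l_i}$. Conventions: $0^0=1$; for $n=0$ the only partition is the empty one ($k=0$), whose term is $E[F]$. *)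

theory Defs
  imports "HOL-Probability.Probability"
begin

text \<open>The space \<open>X\<close> is the universe of a type of class \<^class>\<open>metric_space\<close>.\<close>

definition sigma_compact_space :: "'a::topological_space itself \<Rightarrow> bool" where
  "sigma_compact_space _ \<longleftrightarrow>
     (\<exists>K :: nat \<Rightarrow> 'a set. (\<forall>n. compact (K n)) \<and> (\<Union>n. K n) = UNIV)"

definition diffuse :: "'a measure \<Rightarrow> bool" where
  "diffuse \<sigma> \<longleftrightarrow> (\<forall>x \<in> space \<sigma>. emeasure \<sigma> {x} = 0)"

definition configurations :: "'a::topological_space set set" where
  "configurations = {\<omega>. countable \<omega> \<and> (\<forall>K. compact K \<longrightarrow> finite (\<omega> \<inter> K))}"

text \<open>The sum of the Dirac measures at the points of \<open>\<omega>\<close>, on the Borel sets: counting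
  measure on \<open>\<omega>\<close> pushed forward along the inclusion.\<close>

definition point_measure_of :: "'a::topological_space set \<Rightarrow> 'a measure" where
  "point_measure_of \<omega> = distr (count_space \<omega>) borel (\<lambda>x. x)"

definition configuration_space :: "'a::topological_space set measure" where
  "configuration_space = sigma configurations
     {{\<omega> \<in> configurations. emeasure (point_measure_of \<omega>) A \<in> B} | A B.
        A \<in> sets borel \<and> B \<in> sets (borel :: ennreal measure)}"

text \<open>The Poisson law is given by its weights instead of \<^const>\<open>poisson_pmf\<close>, because the
  latter is specified for positive rates only and \<open>\<sigma>(A\<^sub>i) = 0\<close> has to be allowed;
  at rate \<open>0\<close> the weights below are those of the point mass at \<open>0\<close>.\<close>

definition poisson_measure :: "'a::topological_space measure \<Rightarrow> 'a set measure \<Rightarrow> bool" where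
  "poisson_measure \<sigma> \<pi> \<longleftrightarrow>
     prob_space \<pi> \<and> sets \<pi> = sets configuration_space \<and>
     (\<forall>(m::nat) A. (\<forall>i<m. compact (A i)) \<and> disjoint_family_on A {..<m} \<longrightarrow>
        prob_space.indep_vars \<pi> (\<lambda>_. borel)
          (\<lambda>i \<omega>. emeasure (point_measure_of \<omega>) (A i)) {..<m} \<and>
        (\<forall>i<m. \<forall>k::nat.
           measure \<pi> {\<omega> \<in> space \<pi>. emeasure (point_measure_of \<omega>) (A i) = of_nat k} =
           measure \<sigma> (A i) ^ k / fact k * exp (- measure \<sigma> (A i))))"

definition bounded_process :: "('a::topological_space set \<Rightarrow> 'a \<Rightarrow> real) \<Rightarrow> bool" where
  "bounded_process u \<longleftrightarrow> (\<exists>C. \<forall>\<omega>\<in>configurations. \<forall>x. \<bar>u \<omega> x\<bar> \<le> C)"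

definition compactly_supported_process ::
    "('a::topological_space set \<Rightarrow> 'a \<Rightarrow> real) \<Rightarrow> bool" where
  "compactly_supported_process u \<longleftrightarrow>
     (\<exists>K. compact K \<and> (\<forall>\<omega>\<in>configurations. \<forall>x. x \<notin> K \<longrightarrow> u \<omega> x = 0))"

text \<open>The operator \<open>\<epsilon>\<^sup>+\<close> adding the points \<open>s i\<close>, \<open>i \<in> I\<close>.\<close>

definition add_points ::
    "'i set \<Rightarrow> ('i \<Rightarrow> 'a) \<Rightarrow> ('a set \<Rightarrow> real) \<Rightarrow> 'a set \<Rightarrow> real" where
  "add_points I s G \<omega> = G (\<omega> \<union> s ` I)"

end

theory Submission
  imports Defs
begin

text \<open>The heart of the matter is Mecke's formula
  \<open>E[\<Sum>\<^sub>x\<^sub>\<in>\<^sub>\<omega> G(\<omega>, x)] = E[\<integral> G(\<omega> \<union> {x}, x) \<sigma>(dx)]\<close>. For an event that prescribes the counts of finitely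
  many compact sets, these sets are cut into disjoint atoms; each atom is an increasing union of compact
  sets, so the atoms still have independent Poisson counts, and the formula reduces to the identity
  \<open>E[f(N) N] = \<lambda> E[f(N + 1)]\<close> for a Poisson variable \<open>N\<close>; such events generate the \<open>\<sigma>\<close>-algebra.
  Iterating Mecke's formula, with \<open>\<sigma>\<close> diffuse so that an added point is almost surely new, yields its
  version for sums over injective families of points of \<open>\<omega>\<close>. Finally the \<open>n\<close>-th power of a sum over
  \<open>\<omega>\<close> is a sum over maps \<open>{1..n} \<rightarrow> \<omega>\<close>, and each map is a partition (into its fibres) together with
  an injective labelling of the blocks.\<close>

text \<open>The type class provides a metric but no countable base, so the product of the Borel
  \<sigma>-algebras need not contain every open set of the product space. Sigma-compactness supplies
  a countable dense set, hence a measurable diagonal, and on the diagonal rests the measurability of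
  \<open>x \<in> \<omega>\<close>, of \<open>insert x \<omega>\<close> and of the condition that two
  points differ. Mecke's formula is first proved for \<open>ennreal\<close>-valued integrands, where
  sums and integrals exist without side conditions. The complement steps of the Dynkin arguments
  subtract and therefore need finiteness; this is why these arguments run inside a compact set, and
  the space is exhausted afterwards. Real integrands return at the end. Boundedness and compact
  support bound the \<sigma>-integral uniformly in \<omega>, and Mecke's formula itself carries
  integrability over to the random sum, in place of a moment estimate for Poisson counts. Added
  points are indexed by an arbitrary finite set, finally by the blocks of a partition, so that
  blocks never have to be enumerated.\<close>

section \<open>Countable dense sets and the diagonal in a sigma-compact metric space\<close>

lemma sigma_compact_exhaustion:
  assumes "sigma_compact_space TYPE('a::topological_space)"
  obtains K :: "nat \<Rightarrow> 'a::topological_space set" where "\<And>n. compact (K n)" "incseq K" "(\<Union>n. K n) = UNIV"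
proof -
  obtain K :: "nat \<Rightarrow> 'a set" where K: "\<And>n. compact (K n)" "(\<Union>n. K n) = UNIV"
    using assms by (auto simp: sigma_compact_space_def)
  show thesis
  proof
    show "compact (\<Union>i\<le>n. K i)" for n using K by auto
    show "incseq (\<lambda>n. \<Union>i\<le>n. K i)" by (force simp: incseq_def)
    show "(\<Union>n. \<Union>i\<le>n. K i) = UNIV" using K by blast
  qed
qed

text \<open>Compact sets are totally bounded: each \<open>K n\<close> has a finite net of mesh
  \<open>1/(m+1)\<close>, and the union of these nets over all \<open>n\<close> and \<open>m\<close>
  is countable and dense.\<close>

lemma sigma_compact_countable_dense:
  assumes "sigma_compact_space TYPE('a::metric_space)"
  obtains D :: "'a::metric_space set" where "countable D" "\<And>x e. 0 < e \<Longrightarrow> \<exists>d\<in>D. dist d x < e"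
proof -
  obtain K :: "nat \<Rightarrow> 'a set" where K: "\<And>n. compact (K n)" "(\<Union>n. K n) = UNIV"
    using sigma_compact_exhaustion[OF assms] by metis
  have "\<exists>k. finite k \<and> K n \<subseteq> (\<Union>x\<in>k. ball x (inverse (real (Suc m))))" for n m
    using seq_compact_imp_totally_bounded[of "K n"] K(1)[of n]
    by (metis compact_imp_seq_compact inverse_positive_iff_positive of_nat_0_less_iff zero_less_Suc)
  then obtain k where k: "\<And>n m. finite (k n m)"
    "\<And>n m. K n \<subseteq> (\<Union>x\<in>k n m. ball x (inverse (real (Suc m))))" by metis
  show thesis
  proof
    show "countable (\<Union>n m. k n m)" using k(1) by (simp add: countable_finite)
    fix x :: 'a and e :: real assume "0 < e"
    then obtain m where m: "inverse (real (Suc m)) < e" using reals_Archimedean by blast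
    obtain n where "x \<in> K n" using K(2) by blast
    then obtain d where "d \<in> k n m" "dist d x < inverse (real (Suc m))" using k(2)[of n m] by auto
    with m show "\<exists>d\<in>(\<Union>n m. k n m). dist d x < e" by (intro bexI[of _ d]) auto
  qed
qed

text \<open>Closedness of the diagonal does not put it into the product \<sigma>-algebra. Two points
  coincide iff for every \<open>m\<close> some ball of radius \<open>1/(m+1)\<close> around a point
  of the countable dense set contains both, which exhibits the diagonal through countably many
  measurable squares.\<close>

lemma diagonal_measurable:
  assumes "sigma_compact_space TYPE('a::metric_space)"
  shows "{z. fst z = snd z} \<in> sets (borel \<Otimes>\<^sub>M (borel :: 'a::metric_space measure))"
proof -
  obtain D :: "'a set" where D: "countable D" "\<And>x e. 0 < e \<Longrightarrow> \<exists>d\<in>D. dist d x < e"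
    using sigma_compact_countable_dense[OF assms] by metis
  let ?B = "\<lambda>d m. ball d (inverse (real (Suc m)))"
  have *: "{z. fst z = snd z} = (\<Inter>m. \<Union>d\<in>D. ?B d m \<times> ?B d m)"
  proof (intro set_eqI iffI)
    fix z :: "'a \<times> 'a" assume "z \<in> (\<Inter>m. \<Union>d\<in>D. ?B d m \<times> ?B d m)"
    then have z: "\<exists>d. dist d (fst z) < inverse (real (Suc m)) \<and> dist d (snd z) < inverse (real (Suc m))" for m
      by (auto simp: mem_Times_iff)
    have "dist (fst z) (snd z) \<le> e" if e: "0 < e" for e
    proof -
      obtain m where m: "inverse (real (Suc m)) < e / 2" using reals_Archimedean[OF half_gt_zero[OF e]] by blast
      obtain d where "dist d (fst z) < inverse (real (Suc m))" "dist d (snd z) < inverse (real (Suc m))"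
        using z by blast
      with m dist_triangle3[of "fst z" "snd z" d] show ?thesis by linarith
    qed
    then have "dist (fst z) (snd z) \<le> 0" by (rule field_le_epsilon[of _ 0, simplified])
    then show "z \<in> {z. fst z = snd z}" by simp
  next
    fix z :: "'a \<times> 'a" assume z: "z \<in> {z. fst z = snd z}"
    show "z \<in> (\<Inter>m. \<Union>d\<in>D. ?B d m \<times> ?B d m)"
    proof
      fix m
      obtain d where "d \<in> D" "dist d (fst z) < inverse (real (Suc m))"
        using D(2)[of "inverse (real (Suc m))" "fst z"] by auto
      then show "z \<in> (\<Union>d\<in>D. ?B d m \<times> ?B d m)" using z by (auto simp: mem_Times_iff)
    qed
  qed
  have "UNIV \<in> sets (borel \<Otimes>\<^sub>M (borel :: 'a measure))"
    using sets.top[of "borel \<Otimes>\<^sub>M (borel :: 'a measure)"] by (simp add: space_pair_measure)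
  then show ?thesis unfolding *
    by (intro sets.countable_INT'' sets.countable_UN' D pair_measureI) auto
qed

subsection \<open>Measurability on the configuration space\<close>

lemma space_configuration_space [simp]: "space configuration_space = configurations"
  by (simp add: configuration_space_def space_measure_of_conv)

lemma configurations_finite_Int: "\<omega> \<in> configurations \<Longrightarrow> compact K \<Longrightarrow> finite (\<omega> \<inter> K)"
  by (auto simp: configurations_def)

lemma configurations_Un: "\<omega> \<in> configurations \<Longrightarrow> finite A \<Longrightarrow> \<omega> \<union> A \<in> configurations"
  by (auto simp: configurations_def Int_Un_distrib2 countable_finite)

lemma configurations_insert: "\<omega> \<in> configurations \<Longrightarrow> insert x \<omega> \<in> configurations"
  using configurations_Un[of \<omega> "{x}"] by simp

lemma nn_integral_point_measure_of:
  assumes [measurable]: "f \<in> borel_measurable borel"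
  shows "(\<integral>\<^sup>+x. f x \<partial>point_measure_of \<omega>) = (\<integral>\<^sup>+x. f x \<partial>count_space \<omega>)"
  unfolding point_measure_of_def by (subst nn_integral_distr) auto

lemma sets_point_measure_of [simp]: "sets (point_measure_of \<omega>) = sets borel"
  by (simp add: point_measure_of_def)

lemma emeasure_point_measure_of:
  assumes A: "A \<in> sets borel"
  shows "emeasure (point_measure_of \<omega>) A = (\<integral>\<^sup>+x. indicator A x \<partial>count_space \<omega>)"
proof -
  have "emeasure (point_measure_of \<omega>) A = (\<integral>\<^sup>+x. indicator A x \<partial>point_measure_of \<omega>)"
    using A by simp
  then show ?thesis using A by (simp add: nn_integral_point_measure_of del: nn_integral_indicator)
qed

lemma emeasure_point_measure_of_finite:
  assumes A: "A \<in> sets borel" "finite (\<omega> \<inter> A)"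
  shows "emeasure (point_measure_of \<omega>) A = of_nat (card (\<omega> \<inter> A))"
  unfolding emeasure_point_measure_of[OF A(1)]
  by (subst nn_integral_count_space'[OF A(2)]) (auto simp: indicator_def)

lemma measurable_count [measurable]:
  assumes "A \<in> sets borel"
  shows "(\<lambda>\<omega>. emeasure (point_measure_of \<omega>) A) \<in> borel_measurable configuration_space"
proof (rule measurableI)
  fix B :: "ennreal set" assume "B \<in> sets borel"
  then show "(\<lambda>\<omega>. emeasure (point_measure_of \<omega>) A) -` B \<inter> space configuration_space \<in> sets configuration_space"
    unfolding space_configuration_space unfolding configuration_space_def
    by (subst sets_measure_of, blast, intro sigma_sets.Basic) (use assms in blast)
qed simp

text \<open>Monotone convergence. It removes the compact windows to which arguments by subtraction
  are confined.\<close>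

lemma nn_integral_count_space_exhaustion:
  fixes f :: "'a \<Rightarrow> ennreal"
  assumes "incseq K" "(\<Union>n. K n) = UNIV"
  shows "(\<integral>\<^sup>+x. f x \<partial>count_space S) = (SUP n. \<integral>\<^sup>+x. f x * indicator (K n) x \<partial>count_space S)"
proof -
  have *: "f x = (SUP n. f x * indicator (K n) x)" for x
  proof (rule antisym)
    obtain n where "x \<in> K n" using assms by blast
    then show "f x \<le> (SUP n. f x * indicator (K n) x)" by (intro SUP_upper2[of n]) auto
  qed (auto intro!: SUP_least split: split_indicator)
  have "incseq (\<lambda>n x. f x * indicator (K n) x)"
    using assms(1) by (auto simp: incseq_def le_fun_def split: split_indicator)
  then show ?thesis by (subst *, subst nn_integral_monotone_convergence_SUP) auto
qed

text \<open>Here both the configuration and the integrand depend on the parameter \<open>z\<close>;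
  this generality allows points already chosen to be carried along as part of \<open>z\<close>. A
  rectangle contributes an indicator times the count of a Borel set, a Dynkin argument inside
  \<open>K n\<close> reaches all product sets, and exhaustion followed by monotone approximation
  reaches all integrands.\<close>

lemma measurable_nn_integral_configuration:
  fixes h :: "'z \<Rightarrow> 'a::metric_space set"
  assumes sc: "sigma_compact_space TYPE('a)"
    and h[measurable]: "h \<in> M \<rightarrow>\<^sub>M configuration_space"
    and g: "(\<lambda>(z, x). g z x) \<in> borel_measurable (M \<Otimes>\<^sub>M borel)"
  shows "(\<lambda>z. \<integral>\<^sup>+x. g z x \<partial>count_space (h z)) \<in> borel_measurable M"
proof -
  obtain K :: "nat \<Rightarrow> 'a set" where K: "\<And>n. compact (K n)" "incseq K" "(\<Union>n. K n) = UNIV"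
    using sigma_compact_exhaustion[OF sc] by metis
  have hz: "h z \<in> configurations" if "z \<in> space M" for z
    using measurable_space[OF h that] by simp
  have count[measurable]: "(\<lambda>z. \<integral>\<^sup>+x. indicator A x \<partial>count_space (h z)) \<in> borel_measurable M" if "A \<in> sets borel" for A
    unfolding emeasure_point_measure_of[OF that, symmetric]
    using measurable_compose[OF h measurable_count[OF that]] .
  \<comment> \<open>A configuration has finitely many points in \<open>K n\<close>; this licenses
    the \<open>ennreal\<close> subtraction in the complement case.\<close>
  have fin: "(\<integral>\<^sup>+x. indicator (A x) z * indicator (K n) x \<partial>count_space (h z)) \<noteq> \<infinity>"
    if "z \<in> space M" for z n and A :: "'a \<Rightarrow> 'z set"
  proof -
    have "(\<integral>\<^sup>+x. indicator (A x) z * indicator (K n) x \<partial>count_space (h z)) \<le> (\<integral>\<^sup>+x. indicator (K n) x \<partial>count_space (h z))"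
      by (intro nn_integral_mono) (auto split: split_indicator)
    also have "\<dots> = of_nat (card (h z \<inter> K n))"
      using emeasure_point_measure_of_finite[OF borel_compact[OF K(1)]] configurations_finite_Int[OF hz K(1)] that
      by (metis emeasure_point_measure_of borel_compact[OF K(1)])
    finally show ?thesis by (auto simp: top_unique)
  qed
  have sets_case: "(\<lambda>z. \<integral>\<^sup>+x. indicator E (z, x) * indicator (K n) x \<partial>count_space (h z)) \<in> borel_measurable M"
    if "E \<in> sets (M \<Otimes>\<^sub>M borel)" for E n
    using Int_stable_pair_measure_generator pair_measure_closed that unfolding sets_pair_measure
  proof (induct rule: sigma_sets_induct_disjoint)
    case (basic E)
    then obtain A B where E: "E = A \<times> B" and [measurable]: "A \<in> sets M" "B \<in> sets borel" by auto
    have [measurable]: "B \<inter> K n \<in> sets borel" using borel_compact[OF K(1)] by auto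
    have "(\<lambda>z. indicator A z * \<integral>\<^sup>+x. indicator (B \<inter> K n) x \<partial>count_space (h z)) \<in> borel_measurable M"
      by measurable
    then show ?case
      unfolding E by (simp add: indicator_times indicator_inter_arith mult.assoc nn_integral_cmult)
  next
    case (compl E)
    let ?I = "\<lambda>z. \<integral>\<^sup>+x. indicator E (z, x) * indicator (K n) x \<partial>count_space (h z)"
    have [measurable]: "?I \<in> borel_measurable M" by fact
    have [measurable]: "K n \<in> sets borel" using borel_compact[OF K(1)] .
    have "(\<lambda>z. (\<integral>\<^sup>+x. indicator (K n) x \<partial>count_space (h z)) - ?I z) \<in> borel_measurable M" by measurable
    moreover have "(\<integral>\<^sup>+x. indicator (space M \<times> space borel - E) (z, x) * indicator (K n) x \<partial>count_space (h z))
      = (\<integral>\<^sup>+x. indicator (K n) x \<partial>count_space (h z)) - ?I z" if z: "z \<in> space M" for z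
    proof -
      have "(\<integral>\<^sup>+x. indicator (K n) x \<partial>count_space (h z))
        = (\<integral>\<^sup>+x. indicator (space M \<times> space borel - E) (z, x) * indicator (K n) x + indicator E (z, x) * indicator (K n) x \<partial>count_space (h z))"
        using z by (intro nn_integral_cong) (auto split: split_indicator)
      also have "\<dots> = (\<integral>\<^sup>+x. indicator (space M \<times> space borel - E) (z, x) * indicator (K n) x \<partial>count_space (h z)) + ?I z"
        by (subst nn_integral_add) auto
      finally show ?thesis
        using fin[OF z, of "\<lambda>x. {z. (z, x) \<in> E}" n] by (simp add: indicator_def)
    qed
    ultimately show ?case by (simp cong: measurable_cong)
  next
    case (union A)
    then have [measurable]: "(\<lambda>z. \<integral>\<^sup>+x. indicator (A i) (z, x) * indicator (K n) x \<partial>count_space (h z)) \<in> borel_measurable M" for i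
      by auto
    have "(\<integral>\<^sup>+x. indicator (\<Union> (range A)) (z, x) * indicator (K n) x \<partial>count_space (h z))
      = (\<Sum>i. \<integral>\<^sup>+x. indicator (A i) (z, x) * indicator (K n) x \<partial>count_space (h z))" for z
      by (subst nn_integral_suminf[symmetric])
        (auto simp: suminf_indicator[OF union(1), symmetric] intro!: nn_integral_cong)
    then show ?case by simp
  qed simp
  have sets_case': "(\<lambda>z. \<integral>\<^sup>+x. indicator E (z, x) \<partial>count_space (h z)) \<in> borel_measurable M"
    if "E \<in> sets (M \<Otimes>\<^sub>M borel)" for E
    by (subst nn_integral_count_space_exhaustion[OF K(2,3)]) (use sets_case[OF that] in \<open>intro borel_measurable_SUP; simp\<close>)
  have "(\<lambda>z. \<integral>\<^sup>+x. G (z, x) \<partial>count_space (h z)) \<in> borel_measurable M"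
    if "G \<in> borel_measurable (M \<Otimes>\<^sub>M borel)" for G :: "_ \<Rightarrow> ennreal"
    using that
  proof induct
    case (cong f g)
    have "(\<integral>\<^sup>+x. f (z, x) \<partial>count_space (h z)) = (\<integral>\<^sup>+x. g (z, x) \<partial>count_space (h z))" if "z \<in> space M" for z
      using that cong(3) by (intro nn_integral_cong) (auto simp: space_pair_measure)
    with cong(4) show ?case by (simp cong: measurable_cong)
  next
    case (set A) then show ?case by (rule sets_case')
  next
    case (mult u c)
    then show ?case by (simp add: nn_integral_cmult)
  next
    case (add u v)
    then show ?case by (simp add: nn_integral_add)
  next
    case (seq U)
    have "(\<lambda>z. SUP i. \<integral>\<^sup>+x. U i (z, x) \<partial>count_space (h z)) \<in> borel_measurable M"
      using seq by (intro borel_measurable_SUP) auto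
    moreover have "(\<integral>\<^sup>+x. (SUP i. U i) (z, x) \<partial>count_space (h z)) = (SUP i. \<integral>\<^sup>+x. U i (z, x) \<partial>count_space (h z))" for z
      unfolding SUP_apply using \<open>incseq U\<close>
      by (intro nn_integral_monotone_convergence_SUP) (auto simp: incseq_def le_fun_def)
    ultimately show ?case by simp
  qed
  from this[OF g] show ?thesis by simp
qed

text \<open>Membership is a count: summing the indicator of \<open>f z = x\<close> over the points
  \<open>x\<close> of \<open>h z\<close> gives 1 or 0. The integrand is measurable because the
  diagonal is.\<close>

lemma measurable_mem_configuration:
  assumes sc: "sigma_compact_space TYPE('a::metric_space)"
    and h[measurable]: "h \<in> M \<rightarrow>\<^sub>M configuration_space" "f \<in> M \<rightarrow>\<^sub>M (borel :: 'a::metric_space measure)"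
  shows "Measurable.pred M (\<lambda>z. f z \<in> h z)"
proof -
  have [measurable]: "Measurable.pred (borel \<Otimes>\<^sub>M borel) (\<lambda>z::'a \<times> 'a. fst z = snd z)"
    using diagonal_measurable[OF sc] by (simp add: pred_def space_pair_measure)
  have "(\<lambda>p. (f (fst p), snd p)) \<in> M \<Otimes>\<^sub>M borel \<rightarrow>\<^sub>M (borel \<Otimes>\<^sub>M borel)" by measurable
  from measurable_compose[OF this, of "\<lambda>z. fst z = snd z"]
  have [measurable]: "Measurable.pred (M \<Otimes>\<^sub>M borel) (\<lambda>p. f (fst p) = snd p)" by simp
  have "(\<lambda>z. \<integral>\<^sup>+x. of_bool (f z = x) \<partial>count_space (h z)) \<in> borel_measurable M"
    by (rule measurable_nn_integral_configuration[OF sc]) (auto simp: split_beta')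
  moreover have "(\<integral>\<^sup>+x. of_bool (f z = x) \<partial>count_space (h z)) = (of_bool (f z \<in> h z) :: ennreal)" for z
    by (subst of_bool_Bex_eq_nn_integral[symmetric]) auto
  ultimately have "(\<lambda>z. of_bool (f z \<in> h z) :: ennreal) \<in> borel_measurable M" by simp
  then have [measurable]: "Measurable.pred M (\<lambda>z. of_bool (f z \<in> h z) = (1::ennreal))"
    by measurable
  then show ?thesis by (rule measurable_cong[THEN iffD1, rotated]) auto
qed

lemma measurable_configuration_spaceI:
  fixes h :: "'z \<Rightarrow> 'a::topological_space set"
  assumes "\<And>z. z \<in> space M \<Longrightarrow> h z \<in> configurations"
    and "\<And>A. A \<in> sets borel \<Longrightarrow> (\<lambda>z. emeasure (point_measure_of (h z)) A) \<in> borel_measurable M"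
  shows "h \<in> M \<rightarrow>\<^sub>M configuration_space"
  unfolding configuration_space_def
proof (rule measurable_measure_of)
  fix X :: "'a set set" assume "X \<in> {{\<omega> \<in> configurations. emeasure (point_measure_of \<omega>) A \<in> B} | A B.
        A \<in> sets borel \<and> B \<in> sets (borel :: ennreal measure)}"
  then obtain A and B :: "ennreal set" where [measurable]: "A \<in> sets borel" "B \<in> sets borel"
    and X: "X = {\<omega> \<in> configurations. emeasure (point_measure_of \<omega>) A \<in> B}" by auto
  have "h -` X \<inter> space M = (\<lambda>z. emeasure (point_measure_of (h z)) A) -` B \<inter> space M"
    using assms(1) by (auto simp: X)
  then show "h -` X \<inter> space M \<in> sets M" using assms(2) by simp
qed (use assms in auto)

text \<open>A configuration is a set, so inserting a point raises a count only if the point is new.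
  The correction term thus depends on the event \<open>f z \<in> h z\<close>, whose measurability is
  the preceding result.\<close>

lemma measurable_insert_configuration:
  assumes sc: "sigma_compact_space TYPE('a::metric_space)"
    and h[measurable]: "h \<in> M \<rightarrow>\<^sub>M configuration_space" "f \<in> M \<rightarrow>\<^sub>M (borel :: 'a::metric_space measure)"
  shows "(\<lambda>z. insert (f z) (h z)) \<in> M \<rightarrow>\<^sub>M configuration_space"
proof (rule measurable_configuration_spaceI)
  show "z \<in> space M \<Longrightarrow> insert (f z) (h z) \<in> configurations" for z
    using configurations_insert measurable_space[OF h(1)] by auto
next
  fix A :: "'a set" assume [measurable]: "A \<in> sets borel"
  note measurable_mem_configuration[OF sc h, measurable]
  have "(\<lambda>z. emeasure (point_measure_of (h z)) A) \<in> borel_measurable M"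
    using measurable_compose[OF h(1) measurable_count] by simp
  then have "(\<lambda>z. emeasure (point_measure_of (h z)) A + (if f z \<in> h z then 0 else indicator A (f z))) \<in> borel_measurable M"
    by measurable
  moreover have "emeasure (point_measure_of (insert x \<omega>)) A
     = emeasure (point_measure_of \<omega>) A + (if x \<in> \<omega> then 0 else indicator A x)" for x \<omega>
  proof (cases "x \<in> \<omega>")
    case False
    have "(\<integral>\<^sup>+y. indicator A y \<partial>count_space (insert x \<omega>)) = (\<integral>\<^sup>+y. indicator A y * indicator \<omega> y + indicator A y * indicator {x} y \<partial>count_space UNIV)"
      using False by (subst nn_integral_count_space_indicator) (auto intro!: nn_integral_cong split: split_indicator)
    also have "\<dots> = (\<integral>\<^sup>+y. indicator A y \<partial>count_space \<omega>) + indicator A x"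
      by (subst nn_integral_add) (auto simp: nn_integral_count_space_indicator[symmetric] nn_integral_count_space_finite)
    finally show ?thesis using False by (simp add: emeasure_point_measure_of)
  qed (simp add: insert_absorb)
  ultimately show "(\<lambda>z. emeasure (point_measure_of (insert (f z) (h z))) A) \<in> borel_measurable M"
    by simp
qed

section \<open>Counts of compact sets generate the configuration \<sigma>-algebra\<close>

definition count_event :: "'a::topological_space set set \<Rightarrow> ('a set \<Rightarrow> ennreal set) \<Rightarrow> 'a set set" where
  "count_event AA V = {\<omega> \<in> configurations. \<forall>A\<in>AA. emeasure (point_measure_of \<omega>) A \<in> V A}"

text \<open>The compact sets may overlap: intersecting two such events merges their families of
  sets, which would destroy disjointness. Passing to disjoint sets is left to the atoms.\<close>

definition compact_count_events :: "'a::topological_space set set set" where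
  "compact_count_events =
     {count_event AA V | AA V. finite AA \<and> (\<forall>A\<in>AA. compact A) \<and> (\<forall>A. V A \<in> sets borel)}"

lemma compact_count_events_closed: "compact_count_events \<subseteq> Pow configurations"
  by (auto simp: compact_count_events_def count_event_def)

lemma Int_stable_compact_count_events: "Int_stable compact_count_events"
proof (rule Int_stableI)
  fix a b :: "'a set set" assume "a \<in> compact_count_events" "b \<in> compact_count_events"
  then obtain AA V BB W where *: "a = count_event AA V" "finite AA" "\<forall>A\<in>AA. compact A" "\<forall>A. V A \<in> sets borel"
    "b = count_event BB W" "finite BB" "\<forall>A\<in>BB. compact A" "\<forall>A. W A \<in> sets borel"
    unfolding compact_count_events_def by blast
  \<comment> \<open>A set of both families must meet both targets; \<open>UNIV\<close> stands for a
    constraint that one of the events does not impose.\<close>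
  let ?V = "\<lambda>A. (if A \<in> AA then V A else UNIV) \<inter> (if A \<in> BB then W A else UNIV)"
  have "a \<inter> b = count_event (AA \<union> BB) ?V"
    unfolding * count_event_def by auto
  moreover have "\<forall>A. ?V A \<in> sets borel" using * by auto
  ultimately show "a \<inter> b \<in> compact_count_events" using *
    unfolding compact_count_events_def
    by (auto intro!: exI[of _ "AA \<union> BB"] exI[of _ ?V])
qed

lemma configurations_mem_compact_count_events: "configurations \<in> compact_count_events"
  unfolding compact_count_events_def count_event_def
  by (auto intro!: exI[of _ "{}"] exI[of _ "\<lambda>_. UNIV"])

text \<open>The \<sigma>-algebra is defined by counts of all Borel sets, the Poisson law by counts
  of compact ones. Inside \<open>K n\<close> the Borel sets with measurable count form a Dynkin
  class: closed sets belong to it since they meet \<open>K n\<close> in a compact set, and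
  complements since counts in \<open>K n\<close> are finite. The supremum over \<open>n\<close>
  removes the window.\<close>

lemma sets_configuration_space_eq:
  assumes sc: "sigma_compact_space TYPE('a::metric_space)"
  shows "sets (configuration_space :: 'a set measure) = sigma_sets configurations compact_count_events"
    (is "sets ?C = ?S")
proof
  obtain K :: "nat \<Rightarrow> 'a set" where K: "\<And>n. compact (K n)" "incseq K" "(\<Union>n. K n) = UNIV"
    using sigma_compact_exhaustion[OF sc] by metis
  define M where "M = sigma configurations (compact_count_events :: 'a set set set)"
  have spM: "space M = configurations" and sM: "sets M = ?S"
    using sets_measure_of[OF compact_count_events_closed] by (simp_all add: M_def space_measure_of_conv)
  have comp[measurable]: "(\<lambda>\<omega>. emeasure (point_measure_of \<omega>) L) \<in> borel_measurable M" if L: "compact L" for L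
  proof (rule measurableI)
    fix B :: "ennreal set" assume "B \<in> sets borel"
    then have "count_event {L} (\<lambda>_. B) \<in> compact_count_events"
      unfolding compact_count_events_def using L by auto
    moreover have "(\<lambda>\<omega>. emeasure (point_measure_of \<omega>) L) -` B \<inter> space M = count_event {L} (\<lambda>_. B)"
      by (auto simp: spM count_event_def)
    ultimately show "(\<lambda>\<omega>. emeasure (point_measure_of \<omega>) L) -` B \<inter> space M \<in> sets M"
      using sM by auto
  qed simp
  have bounded: "(\<lambda>\<omega>. emeasure (point_measure_of \<omega>) (A \<inter> K n)) \<in> borel_measurable M"
    if "A \<in> sets borel" for A n
  proof -
    have "Int_stable (Collect closed :: 'a set set)" by (auto simp: Int_stable_def)
    moreover have "Collect closed \<subseteq> Pow (UNIV :: 'a set)" by simp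
    moreover have "A \<in> sigma_sets UNIV (Collect closed)"
      using that unfolding borel_eq_closed by (simp add: sets_measure_of)
    ultimately show ?thesis
    proof (induct rule: sigma_sets_induct_disjoint)
      case (basic A) then show ?case using K(1)[of n] by (intro comp) (auto intro: closed_Int_compact)
    next
      case (compl A)
      then have A: "A \<in> sets borel" by (simp add: borel_eq_closed sets_measure_of)
      have *: "emeasure (point_measure_of \<omega>) ((UNIV - A) \<inter> K n)
        = emeasure (point_measure_of \<omega>) (K n) - emeasure (point_measure_of \<omega>) (A \<inter> K n)" if "\<omega> \<in> space M" for \<omega>
      proof -
        have "(UNIV - A) \<inter> K n = K n - (A \<inter> K n)" by auto
        moreover have "emeasure (point_measure_of \<omega>) (A \<inter> K n) \<noteq> \<infinity>"
          using that A borel_compact[OF K(1)] configurations_finite_Int[OF _ K(1)[of n]]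
          by (subst emeasure_point_measure_of_finite) (auto simp: spM intro: finite_subset[of _ "\<omega> \<inter> K n"])
        ultimately show ?thesis using A borel_compact[OF K(1)] by (simp add: emeasure_Diff)
      qed
      have [measurable]: "(\<lambda>\<omega>. emeasure (point_measure_of \<omega>) (A \<inter> K n)) \<in> borel_measurable M" by fact
      have [measurable]: "(\<lambda>\<omega>. emeasure (point_measure_of \<omega>) (K n)) \<in> borel_measurable M" using comp[OF K(1)] .
      show ?case by (subst measurable_cong[OF *]) auto
    next
      case (union A)
      then have A: "A i \<in> sets borel" for i by (auto simp: borel_eq_closed sets_measure_of)
      have "emeasure (point_measure_of \<omega>) ((\<Union>i. A i) \<inter> K n) = (\<Sum>i. emeasure (point_measure_of \<omega>) (A i \<inter> K n))" for \<omega>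
      proof -
        have "(\<Union>i. A i) \<inter> K n = (\<Union>i. A i \<inter> K n)" by auto
        then show ?thesis using union(1) A borel_compact[OF K(1)]
          by (subst suminf_emeasure) (auto simp: disjoint_family_on_def)
      qed
      moreover have [measurable]: "(\<lambda>\<omega>. emeasure (point_measure_of \<omega>) (A i \<inter> K n)) \<in> borel_measurable M" for i
        using union by auto
      ultimately show ?case by simp
    qed auto
  qed
  \<comment> \<open>Measurability of the identity from \<open>M\<close> is a way of stating the
    inclusion of \<sigma>-algebras.\<close>
  have "(\<lambda>\<omega>. \<omega>) \<in> M \<rightarrow>\<^sub>M ?C"
  proof (rule measurable_configuration_spaceI)
    fix A :: "'a set" assume A: "A \<in> sets borel"
    have "emeasure (point_measure_of \<omega>) A = (SUP n. emeasure (point_measure_of \<omega>) (A \<inter> K n))" for \<omega>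
    proof -
      have "A = (\<Union>n. A \<inter> K n)" using K(3) by auto
      moreover have "incseq (\<lambda>n. A \<inter> K n)" using K(2) by (auto simp: incseq_def)
      ultimately show ?thesis using A borel_compact[OF K(1)]
        by (subst SUP_emeasure_incseq) auto
    qed
    then show "(\<lambda>\<omega>. emeasure (point_measure_of \<omega>) A) \<in> borel_measurable M"
      using bounded[OF A] by (simp add: borel_measurable_SUP)
  qed (auto simp: spM)
  then show "sets ?C \<subseteq> ?S"
    using sets.sets_into_space[where M="?C"] unfolding sM[symmetric]
    by (fastforce simp: measurable_def spM Int_absorb2)
  have "count_event AA V \<in> sets ?C" if "finite AA" "\<forall>A\<in>AA. compact A" "\<forall>A. V A \<in> sets borel" for AA V
  proof -
    have [measurable]: "(\<lambda>\<omega>. emeasure (point_measure_of \<omega>) A) \<in> borel_measurable ?C" if "A \<in> AA" for A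
      using that \<open>\<forall>A\<in>AA. compact A\<close> by (intro measurable_count borel_compact) auto
    have [measurable]: "V A \<in> sets borel" for A using that by auto
    have "{\<omega> \<in> space ?C. \<forall>A\<in>AA. emeasure (point_measure_of \<omega>) A \<in> V A} \<in> sets ?C"
      using that(1) by (intro sets.sets_Collect_finite_All) measurable
    then show ?thesis by (simp add: count_event_def)
  qed
  then have "compact_count_events \<subseteq> sets ?C" by (auto simp: compact_count_events_def)
  then show "?S \<subseteq> sets ?C" using sets.sigma_sets_subset[of compact_count_events ?C] by simp
qed

subsection \<open>Poisson counts of disjoint sets\<close>

text \<open>Atoms of compact sets need not be compact, but they have this form. The compact
  exhaustion \<open>C\<close> gives access to the Poisson law by a limit; the compact bound
  \<open>L\<close> keeps counts and \<sigma>-measure finite.\<close>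

definition Fsigma_bounded :: "'a::metric_space set \<Rightarrow> bool" where
  "Fsigma_bounded A \<longleftrightarrow> (\<exists>C L. (\<forall>n. compact (C n)) \<and> incseq C \<and> A = (\<Union>n::nat. C n) \<and> compact L \<and> A \<subseteq> L)"

lemma Fsigma_bounded_diff:
  fixes K L :: "'a::metric_space set"
  assumes K: "compact K" and L: "compact L"
  shows "Fsigma_bounded (K - L)"
proof (cases "L = {}")
  \<comment> \<open>\<open>infdist\<close> to the empty set is 0 by convention, so the layers of the
    other case would all be empty here.\<close>
  case True
  then show ?thesis unfolding Fsigma_bounded_def
    using K by (intro exI[of _ "\<lambda>_. K"] exI[of _ K]) (auto simp: incseq_def)
next
  case False
  \<comment> \<open>The layers keep distance at least \<open>1/(n+1)\<close> from \<open>L\<close>.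
    They exhaust \<open>K - L\<close> because \<open>L\<close> is closed, so that every point
    outside it has positive distance.\<close>
  let ?C = "\<lambda>n. K \<inter> {x. inverse (real (Suc n)) \<le> infdist x L}"
  have "closed {x. inverse (real (Suc n)) \<le> infdist x L}" for n
    by (intro closed_Collect_le continuous_intros)
  then have "compact (?C n)" for n using K by (intro compact_Int_closed)
  moreover have "incseq ?C"
  proof (rule incseq_SucI)
    fix n
    have "inverse (real (Suc (Suc n))) \<le> inverse (real (Suc n))" by (simp add: field_simps)
    then show "?C n \<subseteq> ?C (Suc n)" using order_trans by blast
  qed
  moreover have "K - L = (\<Union>n. ?C n)"
  proof (intro set_eqI iffI)
    fix x assume x: "x \<in> K - L"
    then have "infdist x L \<noteq> 0" using in_closed_iff_infdist_zero[OF compact_imp_closed[OF L] False] by auto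
    then have "0 < infdist x L" using infdist_nonneg[of x L] by linarith
    then obtain n where "inverse (real (Suc n)) < infdist x L" using reals_Archimedean by blast
    then show "x \<in> (\<Union>n. ?C n)" using x by (auto intro!: exI[of _ n] less_imp_le)
  next
    fix x assume "x \<in> (\<Union>n. ?C n)"
    then obtain n where n: "x \<in> K" "inverse (real (Suc n)) \<le> infdist x L" by auto
    have "0 < inverse (real (Suc n))" by simp
    then show "x \<in> K - L" using n by (auto simp: infdist_zero)
  qed
  ultimately show ?thesis unfolding Fsigma_bounded_def
    using K by (intro exI[of _ ?C] exI[of _ K]) blast
qed

lemma Fsigma_bounded_borel: "Fsigma_bounded A \<Longrightarrow> A \<in> sets borel"
  unfolding Fsigma_bounded_def by (auto intro: borel_compact)

lemma Fsigma_bounded_finite: "Fsigma_bounded A \<Longrightarrow> \<omega> \<in> configurations \<Longrightarrow> finite (\<omega> \<inter> A)"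
  unfolding Fsigma_bounded_def by (metis configurations_finite_Int finite_subset Int_mono order_refl)

definition poisson_weight :: "real \<Rightarrow> nat \<Rightarrow> real" where
  "poisson_weight l k = l ^ k / fact k * exp (- l)"

lemma poisson_weight_nonneg: "0 \<le> l \<Longrightarrow> 0 \<le> poisson_weight l k"
  by (simp add: poisson_weight_def)

text \<open>The relation \<open>(k+1) p(k+1) = l p(k)\<close> is the one-dimensional source of
  Mecke's formula: multiplying by the count amounts to shifting the count by one.\<close>

lemma poisson_weight_Suc: "real (Suc k) * poisson_weight l (Suc k) = l * poisson_weight l k"
proof -
  have "fact (Suc k) = real (Suc k) * fact k" by simp
  then show ?thesis unfolding poisson_weight_def by (simp add: field_simps del: fact_Suc of_nat_Suc)
qed

text \<open>Serves the complement step of Mecke's formula, where a common summand has to be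
  dropped.\<close>

lemma ennreal_add_right_cancel_finite:
  fixes a b c :: ennreal
  assumes "a + c = b + c" "b + c \<noteq> \<infinity>"
  shows "a = b"
  using assms ennreal_add_left_cancel[of c a b] by (auto simp: add.commute)

locale poisson_space =
  fixes \<sigma> :: "'a::metric_space measure" and \<pi> :: "'a set measure"
  assumes sc: "sigma_compact_space TYPE('a)"
    and sets_sigma [measurable_cong]: "sets \<sigma> = sets borel"
    and sigma_finite_sigma: "sigma_finite_measure \<sigma>"
    and diffuse: "diffuse \<sigma>"
    and finite_on_compact: "compact K \<Longrightarrow> emeasure \<sigma> K < \<infinity>"
    and poisson: "poisson_measure \<sigma> \<pi>"
begin

sublocale prob_space \<pi>
  using poisson by (simp add: poisson_measure_def)

sublocale \<sigma>: sigma_finite_measure \<sigma>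
  by (rule sigma_finite_sigma)

lemma sets_pi [measurable_cong]: "sets \<pi> = sets configuration_space"
  using poisson by (simp add: poisson_measure_def)

lemma space_pi [simp]: "space \<pi> = configurations"
  using sets_eq_imp_space_eq[OF sets_pi] by simp

lemma space_sigma [simp]: "space \<sigma> = UNIV"
  using sets_eq_imp_space_eq[OF sets_sigma] by simp

lemma finite_Fsigma_bounded: "Fsigma_bounded A \<Longrightarrow> emeasure \<sigma> A < \<infinity>"
  unfolding Fsigma_bounded_def
  by (metis borel_compact emeasure_mono finite_on_compact order_le_less_trans sets_sigma)

lemma prob_compact_counts:
  fixes A :: "nat \<Rightarrow> 'a set"
  assumes A: "\<And>i. i < m \<Longrightarrow> compact (A i)" "disjoint_family_on A {..<m}"
  shows "measure \<pi> {\<omega> \<in> configurations. \<forall>i<m. card (\<omega> \<inter> A i) = k i}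
    = (\<Prod>i<m. poisson_weight (measure \<sigma> (A i)) (k i))"
proof (cases "m = 0")
  \<comment> \<open>The product formula for independent variables is taken over a nonempty index
    set; for \<open>m = 0\<close> the event is the whole space and the product is empty.\<close>
  case True
  then show ?thesis using prob_space by simp
next
  case False
  let ?X = "\<lambda>i \<omega>. emeasure (point_measure_of \<omega>) (A i)"
  have iv: "indep_vars (\<lambda>_. borel) ?X {..<m}"
    and pw: "\<And>i k. i < m \<Longrightarrow> measure \<pi> {\<omega> \<in> space \<pi>. ?X i \<omega> = of_nat k} = poisson_weight (measure \<sigma> (A i)) k"
    using poisson A unfolding poisson_measure_def poisson_weight_def by blast+
  have X: "?X i \<omega> = of_nat (card (\<omega> \<inter> A i))" if "\<omega> \<in> configurations" "i < m" for i \<omega>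
    using that by (intro emeasure_point_measure_of_finite borel_compact configurations_finite_Int A)
  have "{\<omega> \<in> configurations. \<forall>i<m. card (\<omega> \<inter> A i) = k i} = (\<Inter>i\<in>{..<m}. ?X i -` {of_nat (k i)} \<inter> space \<pi>)"
    using False X by (auto simp: lessThan_empty_iff)
  also have "measure \<pi> \<dots> = (\<Prod>i<m. measure \<pi> (?X i -` {of_nat (k i)} \<inter> space \<pi>))"
    using False by (intro indep_varsD_finite[OF iv]) (auto simp: lessThan_empty_iff)
  also have "\<dots> = (\<Prod>i<m. poisson_weight (measure \<sigma> (A i)) (k i))"
    by (intro prod.cong refl) (auto simp: pw[symmetric] vimage_def Int_def conj_commute)
  finally show ?thesis .
qed

lemma measurable_card_Int:
  assumes "Fsigma_bounded A"
  shows "(\<lambda>\<omega>. card (\<omega> \<inter> A)) \<in> configuration_space \<rightarrow>\<^sub>M count_space UNIV"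
proof -
  have [measurable]: "(\<lambda>\<omega>. emeasure (point_measure_of \<omega>) A) \<in> borel_measurable configuration_space"
    by (intro measurable_count Fsigma_bounded_borel assms)
  have "{\<omega> \<in> space configuration_space. emeasure (point_measure_of \<omega>) A = of_nat k} \<in> sets configuration_space" for k :: nat
    by measurable
  moreover have "(\<lambda>\<omega>. card (\<omega> \<inter> A)) -` {k} \<inter> space configuration_space
    = {\<omega> \<in> space configuration_space. emeasure (point_measure_of \<omega>) A = of_nat k}" for k :: nat
    using assms by (auto simp: emeasure_point_measure_of_finite Fsigma_bounded_borel Fsigma_bounded_finite)
  ultimately show ?thesis
    by (subst measurable_count_space_eq2_countable) auto
qed

text \<open>Events that prescribe exact counts are not monotone in \<open>n\<close>, so continuity
  of the measure along monotone sequences does not apply. Dominated convergence of the indicators,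
  with bound 1, does.\<close>

lemma tendsto_prob_eventually_eq:
  assumes [measurable]: "\<And>n. S n \<in> sets \<pi>" "T \<in> sets \<pi>"
    and ev: "\<And>\<omega>. \<omega> \<in> configurations \<Longrightarrow> \<forall>\<^sub>F n in sequentially. \<omega> \<in> S n \<longleftrightarrow> \<omega> \<in> T"
  shows "(\<lambda>n. measure \<pi> (S n)) \<longlonglongrightarrow> measure \<pi> T"
proof -
  have "(\<lambda>n. \<integral>\<omega>. indicator (S n) \<omega> \<partial>\<pi>) \<longlonglongrightarrow> (\<integral>\<omega>. indicator T \<omega> \<partial>\<pi> :: real)"
  proof (rule integral_dominated_convergence[where w="\<lambda>_. 1"])
    show "AE \<omega> in \<pi>. (\<lambda>n. indicator (S n) \<omega> :: real) \<longlonglongrightarrow> indicator T \<omega>"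
    proof (rule AE_I2)
      fix \<omega> assume "\<omega> \<in> space \<pi>"
      then have "\<forall>\<^sub>F n in sequentially. indicator (S n) \<omega> = (indicator T \<omega> :: real)"
        by (intro eventually_mono[OF ev]) (auto simp: indicator_def)
      then show "(\<lambda>n. indicator (S n) \<omega> :: real) \<longlonglongrightarrow> indicator T \<omega>" by (rule tendsto_eventually)
    qed
  qed (auto split: split_indicator)
  then show ?thesis
    using sets.sets_into_space[OF assms(1)] sets.sets_into_space[OF assms(2)] by (simp add: Int_absorb2)
qed

lemma sets_counts:
  assumes "finite I" "\<And>i. i \<in> I \<Longrightarrow> Fsigma_bounded (A i)"
  shows "{\<omega> \<in> configurations. \<forall>i\<in>I. card (\<omega> \<inter> A i) = k i} \<in> sets \<pi>"
proof -
  have "{\<omega> \<in> space configuration_space. card (\<omega> \<inter> A i) = k i} \<in> sets configuration_space" if "i \<in> I" for i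
    using measurable_sets[OF measurable_card_Int[OF assms(2)[OF that]], of "{k i}"]
    by (simp add: vimage_def Int_def conj_commute)
  then have "{\<omega> \<in> space configuration_space. \<forall>i\<in>I. card (\<omega> \<inter> A i) = k i} \<in> sets configuration_space"
    by (intro sets.sets_Collect_finite_All assms(1))
  then show ?thesis by (simp add: sets_pi)
qed

text \<open>Approximate each \<open>A i\<close> by its compact sets \<open>C i n\<close>, which stay
  disjoint. A configuration has finitely many points in \<open>A i\<close>, and all of them lie in
  \<open>C i n\<close> from some \<open>n\<close> on, so the counts are eventually constant. On the
  other side the measures converge and the Poisson weight is continuous in its rate.\<close>

lemma prob_Fsigma_counts:
  fixes A :: "nat \<Rightarrow> 'a set"
  assumes A: "\<And>i. i < m \<Longrightarrow> Fsigma_bounded (A i)" and disj: "disjoint_family_on A {..<m}"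
  shows "measure \<pi> {\<omega> \<in> configurations. \<forall>i<m. card (\<omega> \<inter> A i) = k i}
    = (\<Prod>i<m. poisson_weight (measure \<sigma> (A i)) (k i))"
proof -
  obtain C where C: "\<And>i n. i < m \<Longrightarrow> compact (C i n)" "\<And>i. i < m \<Longrightarrow> incseq (C i)" "\<And>i. i < m \<Longrightarrow> A i = (\<Union>n::nat. C i n)"
    using A unfolding Fsigma_bounded_def by metis
  have FC: "Fsigma_bounded (C i n)" if "i < m" for i n
    using Fsigma_bounded_diff[OF C(1)[OF that] compact_empty] by simp
  let ?S = "\<lambda>n. {\<omega> \<in> configurations. \<forall>i<m. card (\<omega> \<inter> C i n) = k i}"
  let ?T = "{\<omega> \<in> configurations. \<forall>i<m. card (\<omega> \<inter> A i) = k i}"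
  have S: "?S n \<in> sets \<pi>" for n
    by (rule sets_counts[of "{..<m}" "\<lambda>i. C i n" k, unfolded Ball_def lessThan_iff]) (use FC in auto)
  have T: "?T \<in> sets \<pi>"
    by (rule sets_counts[of "{..<m}" A k, unfolded Ball_def lessThan_iff]) (use A in auto)
  have stable: "\<forall>\<^sub>F n in sequentially. card (\<omega> \<inter> C i n) = card (\<omega> \<inter> A i)" if w: "\<omega> \<in> configurations" and i: "i < m" for \<omega> i
  proof -
    have "\<forall>\<^sub>F n in sequentially. \<forall>x\<in>\<omega> \<inter> A i. x \<in> C i n"
    proof (rule eventually_ball_finite[OF Fsigma_bounded_finite[OF A[OF i] w]], rule ballI)
      fix x assume "x \<in> \<omega> \<inter> A i"
      then obtain n0 where "x \<in> C i n0" using C(3)[OF i] by auto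
      then show "\<forall>\<^sub>F n in sequentially. x \<in> C i n"
        using incseqD[OF C(2)[OF i]] by (auto simp: eventually_sequentially)
    qed
    then have "\<exists>n. \<omega> \<inter> A i \<subseteq> C i n" by (auto dest!: eventually_happens)
    then obtain n0 where n0: "\<omega> \<inter> A i \<subseteq> C i n0" by blast
    have "\<omega> \<inter> C i n = \<omega> \<inter> A i" if "n0 \<le> n" for n
      using n0 incseqD[OF C(2)[OF i] that] C(3)[OF i] by auto
    then show ?thesis by (auto simp: eventually_sequentially intro!: exI[of _ n0])
  qed
  have lim: "(\<lambda>n. measure \<pi> (?S n)) \<longlonglongrightarrow> measure \<pi> ?T"
  proof (rule tendsto_prob_eventually_eq[OF S T])
    fix \<omega> :: "'a set" assume w: "\<omega> \<in> configurations"
    have "\<forall>\<^sub>F n in sequentially. \<forall>i\<in>{..<m}. card (\<omega> \<inter> C i n) = card (\<omega> \<inter> A i)"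
      using stable[OF w] by (intro eventually_ball_finite) auto
    then show "\<forall>\<^sub>F n in sequentially. \<omega> \<in> ?S n \<longleftrightarrow> \<omega> \<in> ?T"
      by eventually_elim auto
  qed
  have lim': "(\<lambda>n. \<Prod>i<m. poisson_weight (measure \<sigma> (C i n)) (k i)) \<longlonglongrightarrow> (\<Prod>i<m. poisson_weight (measure \<sigma> (A i)) (k i))"
  proof (rule tendsto_prod)
    fix i assume "i \<in> {..<m}"
    then have i: "i < m" by simp
    have "(\<lambda>n. measure \<sigma> (C i n)) \<longlonglongrightarrow> measure \<sigma> (A i)"
      unfolding C(3)[OF i]
    proof (rule Lim_measure_incseq)
      show "range (C i) \<subseteq> sets \<sigma>" using C(1)[OF i] borel_compact by (auto simp: sets_sigma)
      show "emeasure \<sigma> (\<Union> (range (C i))) \<noteq> \<infinity>" 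
        using finite_Fsigma_bounded[OF A[OF i]] C(3)[OF i] by simp
    qed (rule C(2)[OF i])
    then show "(\<lambda>n. poisson_weight (measure \<sigma> (C i n)) (k i)) \<longlonglongrightarrow> poisson_weight (measure \<sigma> (A i)) (k i)"
      unfolding poisson_weight_def by (intro tendsto_intros) simp_all
  qed
  have eq: "(\<lambda>n. measure \<pi> (?S n)) = (\<lambda>n. \<Prod>i<m. poisson_weight (measure \<sigma> (C i n)) (k i))"
  proof (rule ext, rule prob_compact_counts)
    fix n
    have "C i n \<subseteq> A i" if "i < m" for i using C(3)[OF that] by auto
    then show "disjoint_family_on (\<lambda>i. C i n) {..<m}"
      using disj unfolding disjoint_family_on_def
      by (metis (no_types, lifting) Int_mono lessThan_iff subset_empty)
  qed (rule C(1))
  show ?thesis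
    by (rule LIMSEQ_unique[OF lim]) (unfold eq, rule lim')
qed

text \<open>Reindexing by a bijection with an initial segment of the naturals; atoms are indexed by
  subfamilies of sets, not by numbers.\<close>

lemma prob_Fsigma_counts_finite:
  assumes I: "finite I" and A: "\<And>i. i \<in> I \<Longrightarrow> Fsigma_bounded (A i)" and disj: "disjoint_family_on A I"
  shows "measure \<pi> {\<omega> \<in> configurations. \<forall>i\<in>I. card (\<omega> \<inter> A i) = k i}
    = (\<Prod>i\<in>I. poisson_weight (measure \<sigma> (A i)) (k i))"
proof -
  obtain h where "bij_betw h {0..<card I} I" using ex_bij_betw_nat_finite[OF I] by blast
  then have h: "bij_betw h {..<card I} I" by (simp add: atLeast0LessThan)
  have I': "I = h ` {..<card I}" using h by (simp add: bij_betw_def)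
  have "(\<Prod>i\<in>I. poisson_weight (measure \<sigma> (A i)) (k i)) = (\<Prod>j<card I. poisson_weight (measure \<sigma> (A (h j))) (k (h j)))"
    by (rule prod.reindex_bij_betw[OF h, symmetric])
  also have "\<dots> = measure \<pi> {\<omega> \<in> configurations. \<forall>j<card I. card (\<omega> \<inter> A (h j)) = k (h j)}"
  proof (rule prob_Fsigma_counts[symmetric])
    show "disjoint_family_on (\<lambda>j. A (h j)) {..<card I}"
      using disj h unfolding disjoint_family_on_def bij_betw_def inj_on_def by blast
  qed (use A h in \<open>auto simp: bij_betw_def\<close>)
  also have "{\<omega> \<in> configurations. \<forall>j<card I. card (\<omega> \<inter> A (h j)) = k (h j)}
     = {\<omega> \<in> configurations. \<forall>i\<in>I. card (\<omega> \<inter> A i) = k i}"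
    using bij_betw_ball[OF h, of "\<lambda>i. card (_ \<inter> A i) = k i"] by (simp add: Ball_def)
  finally show ?thesis by simp
qed


text \<open>The restriction to \<open>I\<close> makes the vector an extensional function. For finite
  \<open>I\<close> these functions form a countable set, so expectations become sums over
  it.\<close>

abbreviation count_vector :: "'i set \<Rightarrow> ('i \<Rightarrow> 'a set) \<Rightarrow> 'a set \<Rightarrow> 'i \<Rightarrow> nat" where
  "count_vector I A \<omega> \<equiv> (\<lambda>i\<in>I. card (\<omega> \<inter> A i))"

text \<open>The events \<open>X k\<close> on which the vector equals \<open>k\<close> split the
  space into countably many pieces, and independence evaluates each as a product of Poisson
  weights.\<close>

lemma nn_integral_count_vector:
  fixes f :: "('i \<Rightarrow> nat) \<Rightarrow> ennreal"
  assumes I: "finite I" and A: "\<And>i. i \<in> I \<Longrightarrow> Fsigma_bounded (A i)" and disj: "disjoint_family_on A I"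
  shows "(\<integral>\<^sup>+\<omega>. f (count_vector I A \<omega>) \<partial>\<pi>) =
    (\<integral>\<^sup>+k. f k * (\<Prod>i\<in>I. ennreal (poisson_weight (measure \<sigma> (A i)) (k i))) \<partial>count_space (PiE I (\<lambda>_. UNIV)))"
proof -
  let ?S = "PiE I (\<lambda>_. UNIV :: nat set)"
  define X where "X k = {\<omega> \<in> configurations. \<forall>i\<in>I. card (\<omega> \<inter> A i) = k i}" for k
  have X[measurable]: "X k \<in> sets \<pi>" for k unfolding X_def by (rule sets_counts[OF I A])
  have eX: "emeasure \<pi> (X k) = (\<Prod>i\<in>I. ennreal (poisson_weight (measure \<sigma> (A i)) (k i)))" for k
  proof -
    have "measure \<pi> (X k) = (\<Prod>i\<in>I. poisson_weight (measure \<sigma> (A i)) (k i))"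
      unfolding X_def by (rule prob_Fsigma_counts_finite[OF I A disj])
    then show ?thesis
      unfolding emeasure_eq_measure by (subst prod_ennreal) (auto intro: poisson_weight_nonneg)
  qed
  have "(\<integral>\<^sup>+\<omega>. f (count_vector I A \<omega>) \<partial>\<pi>) = (\<integral>\<^sup>+\<omega>. \<integral>\<^sup>+k. f k * indicator (X k) \<omega> \<partial>count_space ?S \<partial>\<pi>)"
  proof (rule nn_integral_cong)
    fix \<omega> assume "\<omega> \<in> space \<pi>"
    then have "k \<in> ?S \<Longrightarrow> \<omega> \<in> X k \<longleftrightarrow> k = count_vector I A \<omega>" for k
      by (auto simp: X_def PiE_def extensional_def fun_eq_iff restrict_def)
    then show "f (count_vector I A \<omega>) = (\<integral>\<^sup>+k. f k * indicator (X k) \<omega> \<partial>count_space ?S)"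
      by (subst nn_integral_count_space'[where A="{count_vector I A \<omega>}"]) (auto simp: indicator_def)
  qed
  also have "\<dots> = (\<integral>\<^sup>+k. \<integral>\<^sup>+\<omega>. f k * indicator (X k) \<omega> \<partial>\<pi> \<partial>count_space ?S)"
    using I by (intro nn_integral_count_space_nn_integral countable_PiE) auto
  also have "\<dots> = (\<integral>\<^sup>+k. f k * (\<Prod>i\<in>I. ennreal (poisson_weight (measure \<sigma> (A i)) (k i))) \<partial>count_space ?S)"
    by (simp add: nn_integral_cmult_indicator eX)
  finally show ?thesis .
qed

lemma measurable_count_vector:
  fixes f :: "('i \<Rightarrow> nat) \<Rightarrow> ennreal"
  assumes I: "finite I" and A: "\<And>i. i \<in> I \<Longrightarrow> Fsigma_bounded (A i)"
  shows "(\<lambda>\<omega>. f (count_vector I A \<omega>)) \<in> borel_measurable \<pi>"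
proof (rule measurable_compose[where f="count_vector I A" and g=f and N="count_space (PiE I (\<lambda>_. UNIV))"])
  show "count_vector I A \<in> \<pi> \<rightarrow>\<^sub>M count_space (PiE I (\<lambda>_. UNIV))"
  proof (rule measurable_count_space_eq_countable[THEN iffD2])
    show "countable (PiE I (\<lambda>_. UNIV :: nat set))" using I by (intro countable_PiE) auto
    have "count_vector I A -` {k} \<inter> space \<pi> = {\<omega> \<in> configurations. \<forall>i\<in>I. card (\<omega> \<inter> A i) = k i}"
      if "k \<in> PiE I (\<lambda>_. UNIV :: nat set)" for k
      using that by (auto simp: PiE_def extensional_def fun_eq_iff restrict_def)
    then show "count_vector I A \<in> space \<pi> \<rightarrow> PiE I (\<lambda>_. UNIV) \<and>
        (\<forall>k\<in>PiE I (\<lambda>_. UNIV). count_vector I A -` {k} \<inter> space \<pi> \<in> sets \<pi>)"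
      using sets_counts[OF I A] by simp
  qed
qed simp

text \<open>Write both expectations as sums over vectors \<open>k\<close>. The factor
  \<open>k j\<close> is absorbed by the weight of coordinate \<open>j\<close> through
  \<open>poisson_weight_Suc\<close>, which lowers that coordinate by one and releases the rate
  \<open>emeasure \<sigma> (A j)\<close>; the other coordinates are untouched.\<close>

lemma poisson_size_bias:
  fixes f :: "('i \<Rightarrow> nat) \<Rightarrow> ennreal"
  assumes I: "finite I" and A: "\<And>i. i \<in> I \<Longrightarrow> Fsigma_bounded (A i)" and disj: "disjoint_family_on A I"
    and j: "j \<in> I"
  shows "(\<integral>\<^sup>+\<omega>. f (count_vector I A \<omega>) * of_nat (card (\<omega> \<inter> A j)) \<partial>\<pi>)
    = (\<integral>\<^sup>+\<omega>. f ((count_vector I A \<omega>)(j := Suc (card (\<omega> \<inter> A j)))) \<partial>\<pi>) * emeasure \<sigma> (A j)"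
proof -
  let ?S = "PiE I (\<lambda>_. UNIV :: nat set)"
  define w where "w i k = ennreal (poisson_weight (measure \<sigma> (A i)) k)" for i k
  define p where "p k = (\<Prod>i\<in>I. w i (k i))" for k :: "'i \<Rightarrow> nat"
  have shift: "emeasure \<sigma> (A j) * p k = of_nat (Suc (k j)) * p (k(j := Suc (k j)))" for k
  proof -
    have "emeasure \<sigma> (A j) = ennreal (measure \<sigma> (A j))"
      using finite_Fsigma_bounded[OF A[OF j]] by (intro emeasure_eq_ennreal_measure) auto
    then have "emeasure \<sigma> (A j) * w j (k j) = of_nat (Suc (k j)) * w j (Suc (k j))"
      unfolding w_def ennreal_of_nat_eq_real_of_nat
      by (simp add: ennreal_mult[symmetric] poisson_weight_nonneg poisson_weight_Suc[symmetric] del: of_nat_Suc)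
    moreover have "p k = w j (k j) * (\<Prod>i\<in>I-{j}. w i (k i))" for k
      unfolding p_def using prod.remove[OF I j] .
    ultimately show ?thesis by (simp add: mult.assoc[symmetric] del: of_nat_Suc)
  qed
  \<comment> \<open>\<open>T\<close> is the range of the shift in coordinate \<open>j\<close>.
    Vectors outside it have \<open>k j = 0\<close> and are annihilated by the factor
    \<open>k j\<close>.\<close>
  define T where "T = {k \<in> ?S. k j \<noteq> 0}"
  have bij: "bij_betw (\<lambda>k. k(j := Suc (k j))) ?S T"
  proof (rule bij_betwI[where g="\<lambda>k. k(j := k j - 1)"])
  qed (use j in \<open>auto simp: T_def PiE_def extensional_def\<close>)
  have "(\<integral>\<^sup>+\<omega>. f (count_vector I A \<omega>) * of_nat (card (\<omega> \<inter> A j)) \<partial>\<pi>)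
     = (\<integral>\<^sup>+k. f k * of_nat (k j) * p k \<partial>count_space ?S)"
    unfolding p_def w_def using j
    by (subst nn_integral_count_vector[OF I A disj, of "\<lambda>k. f k * of_nat (k j)", symmetric]) auto
  also have "\<dots> = (\<integral>\<^sup>+k. f k * of_nat (k j) * p k \<partial>count_space T)"
    by (intro nn_integral_count_space_eq) (auto simp: T_def)
  also have "\<dots> = (\<integral>\<^sup>+k. f (k(j := Suc (k j))) * of_nat (Suc (k j)) * p (k(j := Suc (k j))) \<partial>count_space ?S)"
    by (subst nn_integral_bij_count_space[OF bij, symmetric]) simp
  also have "\<dots> = (\<integral>\<^sup>+k. f (k(j := Suc (k j))) * p k * emeasure \<sigma> (A j) \<partial>count_space ?S)"
    using shift by (intro nn_integral_cong) (metis mult.assoc mult.commute)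
  also have "\<dots> = (\<integral>\<^sup>+k. f (k(j := Suc (k j))) * p k \<partial>count_space ?S) * emeasure \<sigma> (A j)"
    by (rule nn_integral_multc) simp
  also have "(\<integral>\<^sup>+k. f (k(j := Suc (k j))) * p k \<partial>count_space ?S)
     = (\<integral>\<^sup>+\<omega>. f ((count_vector I A \<omega>)(j := Suc (card (\<omega> \<inter> A j)))) \<partial>\<pi>)"
    unfolding p_def w_def using j
    by (subst nn_integral_count_vector[OF I A disj, of "\<lambda>k. f (k(j := Suc (k j)))", symmetric]) auto
  finally show ?thesis .
qed

text \<open>Diffuseness enters the proof here: a countable union of null points is null. A new point
  therefore almost surely avoids a given configuration and the points added before.\<close>

lemma AE_not_in_countable: "countable N \<Longrightarrow> AE x in \<sigma>. x \<notin> N"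
proof (rule AE_not_in)
  assume "countable N"
  have "(\<Union>x\<in>N. {x}) \<in> null_sets \<sigma>"
    using diffuse by (intro null_sets_UN' \<open>countable N\<close>) (auto simp: null_sets_def sets_sigma diffuse_def)
  then show "N \<in> null_sets \<sigma>" by simp
qed

lemma configurations_countable: "\<omega> \<in> configurations \<Longrightarrow> countable \<omega>"
  by (simp add: configurations_def)

subsection \<open>Mecke's formula\<close>

text \<open>The points that lie in exactly the members \<open>J\<close> of the family
  \<open>AA\<close>. Different \<open>J\<close> give disjoint atoms.\<close>

definition atom :: "'a set set \<Rightarrow> 'a set set \<Rightarrow> 'a set" where
  "atom AA J = {x. {A \<in> AA. x \<in> A} = J}"

text \<open>The atom is the difference of the compact sets \<open>\<Inter>J\<close> and
  \<open>\<Union>(AA - J)\<close>; the first is compact because \<open>J\<close> has a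
  member.\<close>

lemma Fsigma_bounded_atom:
  assumes "finite AA" "\<And>A. A \<in> AA \<Longrightarrow> compact A" "J \<subseteq> AA" "J \<noteq> {}"
  shows "Fsigma_bounded (atom AA J)"
proof -
  have "atom AA J = \<Inter>J - \<Union>(AA - J)" using assms(3) by (auto simp: atom_def)
  moreover have "compact (\<Inter>J)"
  proof -
    obtain A where "A \<in> J" using assms(4) by blast
    have "compact (A \<inter> \<Inter>J)"
      using assms(2,3) \<open>A \<in> J\<close> by (intro compact_Int_closed closed_Inter ballI compact_imp_closed) auto
    then show ?thesis using \<open>A \<in> J\<close> by (simp add: Inter_lower Int_absorb1)
  qed
  moreover have "compact (\<Union>(AA - J))" using assms by (intro compact_Union) auto
  ultimately show ?thesis using Fsigma_bounded_diff by simp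
qed

text \<open>Since \<open>B\<close> belongs to \<open>AA\<close>, both the event and the count of
  \<open>B\<close> are functions of the vector of atom counts. Size biasing the count of each atom
  inside \<open>B\<close> raises that count by one and yields the measure of the atom. Adding a new
  point \<open>x\<close> of that atom has the same effect on the vector, so summing over the atoms
  in \<open>B\<close> gives the integral over \<open>x\<close>.\<close>

lemma mecke_generator:
  assumes AA: "finite AA" "\<And>A. A \<in> AA \<Longrightarrow> compact A" and B: "B \<in> AA"
  shows "(\<integral>\<^sup>+\<omega>. \<integral>\<^sup>+x. indicator (count_event AA V \<times> B) (\<omega>, x) \<partial>count_space \<omega> \<partial>\<pi>)
    = (\<integral>\<^sup>+\<omega>. \<integral>\<^sup>+x. indicator (count_event AA V \<times> B) (insert x \<omega>, x) \<partial>\<sigma> \<partial>\<pi>)"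
proof -
  \<comment> \<open>The index \<open>{}\<close> is left out: its atom is the complement of all sets
    of \<open>AA\<close>, which need not be bounded and affects neither the event nor
    \<open>B\<close>.\<close>
  define I where "I = Pow AA - {{}}"
  define IB where "IB = {J \<in> I. B \<in> J}"
  let ?A = "atom AA"
  let ?N = "count_vector I ?A"
  have fin: "finite I" "finite IB" using AA by (auto simp: I_def IB_def)
  have FA: "Fsigma_bounded (?A J)" if "J \<in> I" for J
    using that by (intro Fsigma_bounded_atom AA) (auto simp: I_def)
  have disj: "disjoint_family_on ?A I" by (auto simp: disjoint_family_on_def atom_def)
  have union: "A = (\<Union>J\<in>{J \<in> I. A \<in> J}. ?A J)" if "A \<in> AA" for A
    using that by (auto simp: I_def atom_def)
  \<comment> \<open>The event read off from the atom counts: the count of \<open>A\<close> is the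
    sum of the counts of the atoms contained in \<open>A\<close>.\<close>
  define \<Phi> where "\<Phi> k = (\<forall>A\<in>AA. of_nat (\<Sum>J | J \<in> I \<and> A \<in> J. k J) \<in> V A)" for k :: "'a set set \<Rightarrow> nat"
  have finA: "finite (\<omega> \<inter> ?A J)" if "\<omega> \<in> configurations" "J \<in> I" for \<omega> J
    using Fsigma_bounded_finite[OF FA] that by auto
  have card_eq: "card (\<omega> \<inter> A) = (\<Sum>J | J \<in> I \<and> A \<in> J. card (\<omega> \<inter> ?A J))" if "\<omega> \<in> configurations" "A \<in> AA" for \<omega> A
  proof -
    have "\<omega> \<inter> A = (\<Union>J\<in>{J \<in> I. A \<in> J}. \<omega> \<inter> ?A J)" using union[OF that(2)] by auto
    also have "card \<dots> = (\<Sum>J | J \<in> I \<and> A \<in> J. card (\<omega> \<inter> ?A J))"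
      using fin finA[OF that(1)] by (intro card_UN_disjoint) (auto simp: atom_def)
    finally show ?thesis .
  qed
  have event: "\<omega> \<in> count_event AA V \<longleftrightarrow> \<Phi> (?N \<omega>)" if "\<omega> \<in> configurations" for \<omega>
  proof -
    have "emeasure (point_measure_of \<omega>) A = of_nat (\<Sum>J | J \<in> I \<and> A \<in> J. ?N \<omega> J)" if A: "A \<in> AA" for A
      using A \<open>\<omega> \<in> configurations\<close> AA(2)[OF A]
      by (simp add: emeasure_point_measure_of_finite borel_compact configurations_finite_Int card_eq)
    then show ?thesis using that by (simp add: count_event_def \<Phi>_def)
  qed
  have N_insert: "?N (insert x \<omega>) = (?N \<omega>)(J := Suc (card (\<omega> \<inter> ?A J)))"
    if "\<omega> \<in> configurations" "x \<notin> \<omega>" "x \<in> ?A J" "J \<in> I" for x \<omega> J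
  proof
    fix J'
    show "?N (insert x \<omega>) J' = ((?N \<omega>)(J := Suc (card (\<omega> \<inter> ?A J)))) J'"
    proof (cases "J' = J")
      case True
      then show ?thesis using that finA[of \<omega> J] by (simp add: Int_insert_left)
    next
      case False
      then have "x \<notin> ?A J'" using that by (auto simp: atom_def)
      then show ?thesis using False by (simp add: Int_insert_left)
    qed
  qed
  have meas: "(\<lambda>\<omega>. (if \<Phi> (?N \<omega>) then 1 else 0) * of_nat (card (\<omega> \<inter> ?A J)) :: ennreal) \<in> borel_measurable \<pi>" if "J \<in> I" for J
    using measurable_count_vector[where I=I and A="?A" and f="\<lambda>k. (if \<Phi> k then 1 else 0) * of_nat (k J)"] that fin FA by simp
  have meas': "(\<lambda>\<omega>. (if \<Phi> ((?N \<omega>)(J := Suc (card (\<omega> \<inter> ?A J)))) then 1 else 0) :: ennreal) \<in> borel_measurable \<pi>" if "J \<in> I" for J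
    using measurable_count_vector[where I=I and A="?A" and f="\<lambda>k. (if \<Phi> (k(J := Suc (k J))) then 1 else 0)"] that fin FA by simp
  have "(\<integral>\<^sup>+\<omega>. \<integral>\<^sup>+x. indicator (count_event AA V \<times> B) (\<omega>, x) \<partial>count_space \<omega> \<partial>\<pi>)
    = (\<integral>\<^sup>+\<omega>. (\<Sum>J\<in>IB. (if \<Phi> (?N \<omega>) then 1 else 0) * of_nat (card (\<omega> \<inter> ?A J))) \<partial>\<pi>)"
  proof (rule nn_integral_cong)
    fix \<omega> assume "\<omega> \<in> space \<pi>"
    then have w: "\<omega> \<in> configurations" by simp
    have "(\<integral>\<^sup>+x. indicator (count_event AA V \<times> B) (\<omega>, x) \<partial>count_space \<omega>)
      = (\<integral>\<^sup>+x. (if \<Phi> (?N \<omega>) then 1 else 0) * indicator B x \<partial>count_space \<omega>)"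
      using event[OF w] by (intro nn_integral_cong) (auto simp: indicator_def)
    also have "\<dots> = (if \<Phi> (?N \<omega>) then 1 else 0) * emeasure (point_measure_of \<omega>) B"
      using AA(2)[OF B] by (simp add: nn_integral_cmult emeasure_point_measure_of borel_compact)
    also have "emeasure (point_measure_of \<omega>) B = of_nat (card (\<omega> \<inter> B))"
      using AA(2)[OF B] w by (simp add: emeasure_point_measure_of_finite borel_compact configurations_finite_Int)
    also have "card (\<omega> \<inter> B) = (\<Sum>J\<in>IB. card (\<omega> \<inter> ?A J))" using card_eq[OF w B] by (simp add: IB_def)
    finally show "(\<integral>\<^sup>+x. indicator (count_event AA V \<times> B) (\<omega>, x) \<partial>count_space \<omega>)
      = (\<Sum>J\<in>IB. (if \<Phi> (?N \<omega>) then 1 else 0) * of_nat (card (\<omega> \<inter> ?A J)))"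
      by (simp only: sum_distrib_left of_nat_sum)
  qed
  also have "\<dots> = (\<Sum>J\<in>IB. \<integral>\<^sup>+\<omega>. (if \<Phi> (?N \<omega>) then 1 else 0) * of_nat (card (\<omega> \<inter> ?A J)) \<partial>\<pi>)"
    using meas by (intro nn_integral_sum) (auto simp: IB_def)
  also have "\<dots> = (\<Sum>J\<in>IB. (\<integral>\<^sup>+\<omega>. (if \<Phi> ((?N \<omega>)(J := Suc (card (\<omega> \<inter> ?A J)))) then 1 else 0) \<partial>\<pi>) * emeasure \<sigma> (?A J))"
    by (intro sum.cong refl poisson_size_bias[OF fin(1) FA disj]) (auto simp: IB_def)
  also have "\<dots> = (\<integral>\<^sup>+\<omega>. (\<Sum>J\<in>IB. (if \<Phi> ((?N \<omega>)(J := Suc (card (\<omega> \<inter> ?A J)))) then 1 else 0) * emeasure \<sigma> (?A J)) \<partial>\<pi>)"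
    using meas' by (subst nn_integral_sum) (auto simp: IB_def nn_integral_multc)
  also have "\<dots> = (\<integral>\<^sup>+\<omega>. \<integral>\<^sup>+x. indicator (count_event AA V \<times> B) (insert x \<omega>, x) \<partial>\<sigma> \<partial>\<pi>)"
  proof (rule nn_integral_cong)
    fix \<omega> assume "\<omega> \<in> space \<pi>"
    then have w: "\<omega> \<in> configurations" by simp
    define c :: "'a set set \<Rightarrow> ennreal" where "c J = (if \<Phi> ((?N \<omega>)(J := Suc (card (\<omega> \<inter> ?A J)))) then 1 else 0)" for J
    have sA: "?A J \<in> sets \<sigma>" if "J \<in> IB" for J
      using that FA by (auto simp: sets_sigma IB_def intro: Fsigma_bounded_borel)
    \<comment> \<open>For almost every \<open>x\<close> the point is new, so its insertion raises
      the count of its own atom and no other; a point already in \<omega> would leave the vector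
      unchanged.\<close>
    have "(\<integral>\<^sup>+x. indicator (count_event AA V \<times> B) (insert x \<omega>, x) \<partial>\<sigma>)
       = (\<integral>\<^sup>+x. (\<Sum>J\<in>IB. c J * indicator (?A J) x) \<partial>\<sigma>)"
    proof (rule nn_integral_cong_AE, rule AE_mp[OF AE_not_in_countable[OF configurations_countable[OF w]]], rule AE_I2, rule impI)
      fix x assume x: "x \<notin> \<omega>"
      show "indicator (count_event AA V \<times> B) (insert x \<omega>, x) = (\<Sum>J\<in>IB. c J * indicator (?A J) x)"
      proof (cases "x \<in> B")
        case True
        define J where "J = {A \<in> AA. x \<in> A}"
        have J: "J \<in> IB" "x \<in> ?A J" using True B by (auto simp: J_def IB_def I_def atom_def)
        then have "J \<in> I" by (simp add: IB_def)
        have "(\<Sum>J\<in>IB. c J * indicator (?A J) x) = (\<Sum>J'\<in>{J}. c J' * indicator (?A J') x)"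
          using J fin by (intro sum.mono_neutral_right) (auto simp: atom_def indicator_def split: if_splits)
        also have "\<dots> = c J" using J by simp
        also have "\<dots> = indicator (count_event AA V \<times> B) (insert x \<omega>, x)"
          using True event[OF configurations_insert[OF w]] N_insert[OF w x J(2) \<open>J \<in> I\<close>]
          by (simp add: indicator_def c_def)
        finally show ?thesis by simp
      next
        case False
        then have "x \<notin> ?A J" if "J \<in> IB" for J using that by (auto simp: IB_def atom_def)
        then show ?thesis using False by (simp add: indicator_def)
      qed
    qed
    also have "\<dots> = (\<Sum>J\<in>IB. c J * emeasure \<sigma> (?A J))"
      using sA by (subst nn_integral_sum) (auto simp: nn_integral_cmult_indicator)
    finally show "(\<Sum>J\<in>IB. (if \<Phi> ((?N \<omega>)(J := Suc (card (\<omega> \<inter> ?A J)))) then 1 else 0) * emeasure \<sigma> (?A J)) = (\<integral>\<^sup>+x. indicator (count_event AA V \<times> B) (insert x \<omega>, x) \<partial>\<sigma>)"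
      by (simp only: c_def)
  qed
  finally show ?thesis .
qed


section \<open>Measurability of the two sides of Mecke's formula\<close>

lemma measurable_insert_pair [measurable]:
  "(\<lambda>(\<omega>, x). (insert x \<omega>, x)) \<in> configuration_space \<Otimes>\<^sub>M (borel :: 'a measure) \<rightarrow>\<^sub>M configuration_space \<Otimes>\<^sub>M borel"
proof -
  have "(\<lambda>p. insert (snd p) (fst p)) \<in> configuration_space \<Otimes>\<^sub>M (borel :: 'a measure) \<rightarrow>\<^sub>M configuration_space"
    by (rule measurable_insert_configuration[OF sc measurable_fst measurable_snd])
  then show ?thesis by (simp add: split_beta' measurable_Pair)
qed

lemma measurable_sum_configuration:
  assumes "G \<in> borel_measurable (configuration_space \<Otimes>\<^sub>M (borel :: 'a measure))"
  shows "(\<lambda>\<omega>. \<integral>\<^sup>+x. G (\<omega>, x) \<partial>count_space \<omega>) \<in> borel_measurable \<pi>"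
proof -
  have "(\<lambda>\<omega>. \<integral>\<^sup>+x. G (\<omega>, x) \<partial>count_space \<omega>) \<in> borel_measurable configuration_space"
    using assms by (intro measurable_nn_integral_configuration[OF sc]) auto
  then show ?thesis by (simp cong: measurable_cong_sets add: sets_pi)
qed

lemma measurable_insert_integrand:
  assumes "G \<in> borel_measurable (configuration_space \<Otimes>\<^sub>M (borel :: 'a measure))"
  shows "(\<lambda>(\<omega>, x). G (insert x \<omega>, x)) \<in> borel_measurable (\<pi> \<Otimes>\<^sub>M \<sigma>)"
proof -
  have "(\<lambda>z. G ((\<lambda>(\<omega>, x). (insert x \<omega>, x)) z)) \<in> borel_measurable (configuration_space \<Otimes>\<^sub>M (borel :: 'a measure))"
    by (rule measurable_compose[OF measurable_insert_pair assms])
  moreover have "sets (\<pi> \<Otimes>\<^sub>M \<sigma>) = sets (configuration_space \<Otimes>\<^sub>M borel)"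
    using sets_pi sets_sigma by (rule sets_pair_measure_cong)
  ultimately show ?thesis by (simp add: split_beta' cong: measurable_cong_sets)
qed

lemma measurable_integral_insert:
  assumes "G \<in> borel_measurable (configuration_space \<Otimes>\<^sub>M (borel :: 'a measure))"
  shows "(\<lambda>\<omega>. \<integral>\<^sup>+x. G (insert x \<omega>, x) \<partial>\<sigma>) \<in> borel_measurable \<pi>"
  by (rule \<sigma>.borel_measurable_nn_integral[OF measurable_insert_integrand[OF assms]])

lemma measurable_insert_section:
  assumes "G \<in> borel_measurable (configuration_space \<Otimes>\<^sub>M (borel :: 'a measure))" "\<omega> \<in> configurations"
  shows "(\<lambda>x. G (insert x \<omega>, x)) \<in> borel_measurable \<sigma>"
  using measurable_Pair2[OF measurable_insert_integrand[OF assms(1)], of \<omega>] assms(2) by simp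

text \<open>Closed sets are taken in the second component because a closed set meets a compact
  window in a compact set, which can then join the family of a count event.\<close>

lemma sets_configuration_pair_eq:
  "sets ((configuration_space :: 'a set measure) \<Otimes>\<^sub>M (borel :: 'a measure))
    = sigma_sets (configurations \<times> UNIV) {a \<times> b | a b. a \<in> (compact_count_events :: 'a set set set) \<and> b \<in> Collect closed}"
    (is "_ = sigma_sets ?\<Omega> ?G")
proof -
  have "sets ((configuration_space :: 'a set measure) \<Otimes>\<^sub>M (borel :: 'a measure)) = sets (sigma (space configuration_space \<times> space (borel :: 'a measure)) ?G)"
  proof (rule sets_pair_eq)
    show "sets (configuration_space :: 'a set measure) = sigma_sets (space configuration_space) compact_count_events"
      using sets_configuration_space_eq[OF sc] by simp
    show "sets (borel :: 'a measure) = sigma_sets (space borel) (Collect closed)"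
      unfolding borel_eq_closed by (simp add: sets_measure_of space_measure_of_conv)
    show "{configurations} \<subseteq> (compact_count_events :: 'a set set set)"
      using configurations_mem_compact_count_events by simp
    show "compact_count_events \<subseteq> Pow (space (configuration_space :: 'a set measure))"
      using compact_count_events_closed by simp
    show "{UNIV} \<subseteq> Collect (closed :: 'a set \<Rightarrow> bool)" by simp
  qed auto
  moreover have "?G \<subseteq> Pow ?\<Omega>" using compact_count_events_closed by blast
  ultimately show ?thesis by (simp add: sets_measure_of)
qed

section \<open>Extension of Mecke's formula from the generator to measurable integrands\<close>

text \<open>A Dynkin argument over the products of count events and closed sets. The window
  \<open>K\<close> makes the total mass on either side equal to the finite number
  \<open>emeasure \<sigma> K\<close>, as the complement step requires.\<close>

lemma mecke_sets_compact:
  assumes K: "compact K" and E: "E \<in> sets (configuration_space \<Otimes>\<^sub>M borel)"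
  shows "(\<integral>\<^sup>+\<omega>. \<integral>\<^sup>+x. indicator E (\<omega>, x) * indicator K x \<partial>count_space \<omega> \<partial>\<pi>)
    = (\<integral>\<^sup>+\<omega>. \<integral>\<^sup>+x. indicator E (insert x \<omega>, x) * indicator K x \<partial>\<sigma> \<partial>\<pi>)"
proof -
  let ?P = "(configuration_space :: 'a set measure) \<Otimes>\<^sub>M (borel :: 'a measure)"
  let ?G = "{a \<times> b | a b. a \<in> (compact_count_events :: 'a set set set) \<and> b \<in> Collect (closed :: 'a set \<Rightarrow> bool)}"
  let ?\<Omega> = "(configurations :: 'a set set) \<times> (UNIV :: 'a set)"
  let ?l = "\<lambda>E \<omega>. \<integral>\<^sup>+x. indicator E (\<omega>, x) * indicator K x \<partial>count_space \<omega>"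
  let ?r = "\<lambda>E \<omega>. \<integral>\<^sup>+x. indicator E (insert x \<omega>, x) * indicator K x \<partial>\<sigma>"
  have K'[measurable]: "K \<in> sets borel" using K by (rule borel_compact)
  have G: "(\<lambda>z. indicator E z * indicator K (snd z) :: ennreal) \<in> borel_measurable ?P" if [measurable]: "E \<in> sets ?P" for E
    by measurable
  have ml: "?l E \<in> borel_measurable \<pi>" if "E \<in> sets ?P" for E
    using measurable_sum_configuration[OF G[OF that]] by simp
  have mr: "?r E \<in> borel_measurable \<pi>" if "E \<in> sets ?P" for E
    using measurable_integral_insert[OF G[OF that]] by simp
  have ms: "(\<lambda>x. indicator E (insert x \<omega>, x) * indicator K x :: ennreal) \<in> borel_measurable \<sigma>"
    if "E \<in> sets ?P" "\<omega> \<in> configurations" for E \<omega>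
    using measurable_insert_section[OF G[OF that(1)] that(2)] by simp
  have stable: "Int_stable ?G"
  proof (rule Int_stableI)
    fix x y assume "x \<in> ?G" "y \<in> ?G"
    then obtain a b c d where *: "x = a \<times> b" "y = c \<times> d" "a \<in> compact_count_events" "c \<in> compact_count_events" "closed b" "closed d"
      by blast
    have "a \<inter> c \<in> compact_count_events" using Int_stableD[OF Int_stable_compact_count_events] * by blast
    then show "x \<inter> y \<in> ?G" using * by (auto simp: Times_Int_Times)
  qed
  have closed: "?G \<subseteq> Pow ?\<Omega>" using compact_count_events_closed by blast
  have gen: "(\<integral>\<^sup>+\<omega>. ?l E \<omega> \<partial>\<pi>) = (\<integral>\<^sup>+\<omega>. ?r E \<omega> \<partial>\<pi>)" if EG: "E \<in> ?G" for E
  proof -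
    obtain a b where ab: "E = a \<times> b" "a \<in> compact_count_events" "closed b" using EG by blast
    from ab(2) obtain AA V where "a = count_event AA V" "finite AA" "\<forall>A\<in>AA. compact A"
      unfolding compact_count_events_def by blast
    with ab have E: "E = count_event AA V \<times> b" and AA: "finite AA" "\<forall>A\<in>AA. compact A" and b: "closed b" by auto
    define B where "B = b \<inter> K"
    \<comment> \<open>\<open>B\<close> must be a member of the family of test sets. If it is added,
      its target is \<open>UNIV\<close>, so the event does not change; if it is already there, its
      target is kept.\<close>
    define W where "W = (if B \<in> AA then V else V(B := UNIV))"
    have "compact B" using b K by (auto simp: B_def intro: closed_Int_compact)
    have "count_event AA V = count_event (insert B AA) W" by (auto simp: count_event_def W_def)
    then have "indicator E (\<omega>, x) * indicator K x = (indicator (count_event (insert B AA) W \<times> B) (\<omega>, x) :: ennreal)" for \<omega> x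
      unfolding E B_def by (simp add: indicator_def)
    then show ?thesis
      by (simp only:) (rule mecke_generator, use AA \<open>compact B\<close> in auto)
  qed
  have "?\<Omega> \<in> ?G" using configurations_mem_compact_count_events by blast
  have sP: "sets ?P = sigma_sets ?\<Omega> ?G" by (rule sets_configuration_pair_eq)
  have top: "(\<integral>\<^sup>+\<omega>. ?r ?\<Omega> \<omega> \<partial>\<pi>) = emeasure \<sigma> K"
  proof -
    have "(\<integral>\<^sup>+\<omega>. ?r ?\<Omega> \<omega> \<partial>\<pi>) = (\<integral>\<^sup>+\<omega>. emeasure \<sigma> K \<partial>\<pi>)"
    proof (rule nn_integral_cong)
      fix \<omega> assume "\<omega> \<in> space \<pi>"
      then have "?r ?\<Omega> \<omega> = (\<integral>\<^sup>+x. indicator K x \<partial>\<sigma>)"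
        by (intro nn_integral_cong) (auto simp: configurations_insert indicator_def)
      then show "?r ?\<Omega> \<omega> = emeasure \<sigma> K" using K' by (simp add: sets_sigma)
    qed
    then show ?thesis by (simp add: emeasure_space_1[unfolded space_pi])
  qed
  show ?thesis
    using stable closed E[unfolded sP]
  proof (induct rule: sigma_sets_induct_disjoint)
    case (basic E) then show ?case by (rule gen)
  next
    case empty then show ?case by simp
  next
    case (compl E)
    then have E: "E \<in> sets ?P" by (simp add: sP)
    then have E': "?\<Omega> - E \<in> sets ?P" using sets.compl_sets[OF E] by (simp add: space_pair_measure)
    have e1: "(\<integral>\<^sup>+\<omega>. ?l (?\<Omega> - E) \<omega> \<partial>\<pi>) + (\<integral>\<^sup>+\<omega>. ?l E \<omega> \<partial>\<pi>) = (\<integral>\<^sup>+\<omega>. ?l ?\<Omega> \<omega> \<partial>\<pi>)"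
    proof -
      have "?l ?\<Omega> \<omega> = ?l (?\<Omega> - E) \<omega> + ?l E \<omega>" if "\<omega> \<in> space \<pi>" for \<omega>
        using that by (subst nn_integral_add[symmetric]) (auto intro!: nn_integral_cong simp: indicator_def)
      then show ?thesis by (subst nn_integral_add[symmetric]) (auto intro!: ml E E' nn_integral_cong)
    qed
    have e2: "(\<integral>\<^sup>+\<omega>. ?r (?\<Omega> - E) \<omega> \<partial>\<pi>) + (\<integral>\<^sup>+\<omega>. ?r E \<omega> \<partial>\<pi>) = (\<integral>\<^sup>+\<omega>. ?r ?\<Omega> \<omega> \<partial>\<pi>)"
    proof -
      have "?r ?\<Omega> \<omega> = ?r (?\<Omega> - E) \<omega> + ?r E \<omega>" if "\<omega> \<in> space \<pi>" for \<omega>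
      proof -
        have w: "\<omega> \<in> configurations" using that by simp
        have "?r (?\<Omega> - E) \<omega> + ?r E \<omega>
          = (\<integral>\<^sup>+x. indicator (?\<Omega> - E) (insert x \<omega>, x) * indicator K x + indicator E (insert x \<omega>, x) * indicator K x \<partial>\<sigma>)"
          by (rule nn_integral_add[symmetric, OF ms[OF E' w] ms[OF E w]])
        also have "\<dots> = ?r ?\<Omega> \<omega>"
          using w by (intro nn_integral_cong) (auto simp: indicator_def configurations_insert)
        finally show ?thesis by simp
      qed
      then show ?thesis by (subst nn_integral_add[symmetric]) (auto intro!: mr E E' nn_integral_cong)
    qed
    have e3: "(\<integral>\<^sup>+\<omega>. ?l ?\<Omega> \<omega> \<partial>\<pi>) = (\<integral>\<^sup>+\<omega>. ?r ?\<Omega> \<omega> \<partial>\<pi>)" by (rule gen) fact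
    have "(\<integral>\<^sup>+\<omega>. ?l (?\<Omega> - E) \<omega> \<partial>\<pi>) + (\<integral>\<^sup>+\<omega>. ?r E \<omega> \<partial>\<pi>) = (\<integral>\<^sup>+\<omega>. ?l (?\<Omega> - E) \<omega> \<partial>\<pi>) + (\<integral>\<^sup>+\<omega>. ?l E \<omega> \<partial>\<pi>)" by (simp only: compl(2))
    also have "\<dots> = (\<integral>\<^sup>+\<omega>. ?l ?\<Omega> \<omega> \<partial>\<pi>)" by (rule e1)
    also have "\<dots> = (\<integral>\<^sup>+\<omega>. ?r ?\<Omega> \<omega> \<partial>\<pi>)" by (rule e3)
    also have "\<dots> = (\<integral>\<^sup>+\<omega>. ?r (?\<Omega> - E) \<omega> \<partial>\<pi>) + (\<integral>\<^sup>+\<omega>. ?r E \<omega> \<partial>\<pi>)" by (rule e2[symmetric])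
    \<comment> \<open>The common summand is at most the total mass \<sigma>(K), which is finite, and
      may be cancelled.\<close>
    finally show ?case
      by (rule ennreal_add_right_cancel_finite) (unfold e2 top, use finite_on_compact[OF K] in simp)
  next
    case (union A)
    then have A: "A i \<in> sets ?P" for i by (auto simp: sP)
    have ind: "indicator (\<Union> (range A)) z = (\<Sum>i. indicator (A i) z :: ennreal)" for z
      using union(1) by (rule suminf_indicator[symmetric])
    have "(\<integral>\<^sup>+\<omega>. ?l (\<Union> (range A)) \<omega> \<partial>\<pi>) = (\<integral>\<^sup>+\<omega>. (\<Sum>i. ?l (A i) \<omega>) \<partial>\<pi>)"
      by (intro nn_integral_cong) (simp add: ind nn_integral_suminf[symmetric])
    also have "\<dots> = (\<Sum>i. \<integral>\<^sup>+\<omega>. ?l (A i) \<omega> \<partial>\<pi>)"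
      by (intro nn_integral_suminf ml A)
    also have "\<dots> = (\<Sum>i. \<integral>\<^sup>+\<omega>. ?r (A i) \<omega> \<partial>\<pi>)" using union(3) by simp
    also have "\<dots> = (\<integral>\<^sup>+\<omega>. (\<Sum>i. ?r (A i) \<omega>) \<partial>\<pi>)"
      by (intro nn_integral_suminf[symmetric] mr A)
    also have "\<dots> = (\<integral>\<^sup>+\<omega>. ?r (\<Union> (range A)) \<omega> \<partial>\<pi>)"
      by (intro nn_integral_cong, subst nn_integral_suminf[symmetric]) (auto simp: ind intro!: ms A)
    finally show ?case .
  qed
qed

text \<open>Both sides are additive, homogeneous and continuous along increasing sequences, so the
  formula passes from sets to all nonnegative measurable integrands.\<close>

theorem mecke:
  assumes "G \<in> borel_measurable (configuration_space \<Otimes>\<^sub>M borel)"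
  shows "(\<integral>\<^sup>+\<omega>. \<integral>\<^sup>+x. G (\<omega>, x) \<partial>count_space \<omega> \<partial>\<pi>) = (\<integral>\<^sup>+\<omega>. \<integral>\<^sup>+x. G (insert x \<omega>, x) \<partial>\<sigma> \<partial>\<pi>)"
proof -
  let ?P = "(configuration_space :: 'a set measure) \<Otimes>\<^sub>M (borel :: 'a measure)"
  define L where "L G = (\<integral>\<^sup>+\<omega>. \<integral>\<^sup>+x. G (\<omega>, x) \<partial>count_space \<omega> \<partial>\<pi>)" for G
  define R where "R G = (\<integral>\<^sup>+\<omega>. \<integral>\<^sup>+x. G (insert x \<omega>, x) \<partial>\<sigma> \<partial>\<pi>)" for G
  have L_SUP: "L (SUP i. U i) = (SUP i. L (U i))" if U: "\<And>i. U i \<in> borel_measurable ?P" "incseq U" for U :: "nat \<Rightarrow> _"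
  proof -
    have mono: "U i z \<le> U j z" if "i \<le> j" for i j z using U(2) that unfolding incseq_def le_fun_def by blast
    have "L (SUP i. U i) = (\<integral>\<^sup>+\<omega>. (SUP i. \<integral>\<^sup>+x. U i (\<omega>, x) \<partial>count_space \<omega>) \<partial>\<pi>)"
      unfolding L_def SUP_apply
      by (intro nn_integral_cong nn_integral_monotone_convergence_SUP) (auto simp: incseq_def le_fun_def mono)
    also have "\<dots> = (SUP i. L (U i))"
      unfolding L_def by (intro nn_integral_monotone_convergence_SUP measurable_sum_configuration U(1))
        (auto simp: incseq_def le_fun_def mono intro!: nn_integral_mono)
    finally show ?thesis .
  qed
  have R_SUP: "R (SUP i. U i) = (SUP i. R (U i))" if U: "\<And>i. U i \<in> borel_measurable ?P" "incseq U" for U :: "nat \<Rightarrow> _"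
  proof -
    have mono: "U i z \<le> U j z" if "i \<le> j" for i j z using U(2) that unfolding incseq_def le_fun_def by blast
    have "R (SUP i. U i) = (\<integral>\<^sup>+\<omega>. (SUP i. \<integral>\<^sup>+x. U i (insert x \<omega>, x) \<partial>\<sigma>) \<partial>\<pi>)"
      unfolding R_def SUP_apply
      by (intro nn_integral_cong nn_integral_monotone_convergence_SUP measurable_insert_section U(1))
        (auto simp: incseq_def le_fun_def mono)
    also have "\<dots> = (SUP i. R (U i))"
      unfolding R_def by (intro nn_integral_monotone_convergence_SUP measurable_integral_insert U(1))
        (auto simp: incseq_def le_fun_def mono intro!: nn_integral_mono)
    finally show ?thesis .
  qed
  obtain K :: "nat \<Rightarrow> 'a set" where K: "\<And>n. compact (K n)" "incseq K" "(\<Union>n. K n) = UNIV"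
    using sigma_compact_exhaustion[OF sc] by metis
  from assms have "L G = R G"
  proof induct
    case (cong f g)
    have eq: "f (\<omega>, x) = g (\<omega>, x)" if "\<omega> \<in> configurations" for \<omega> x
      using cong(3) that by (auto simp: space_pair_measure)
    have "L f = L g" "R f = R g"
      unfolding L_def R_def by (auto intro!: nn_integral_cong simp: eq configurations_insert)
    then show ?case using cong by simp
  next
    case (set E)
    \<comment> \<open>Truncation to the compact sets \<open>K n\<close>, where the formula is known;
      the supremum over \<open>n\<close> restores the full indicator.\<close>
    define U where "U n z = (indicator E z * indicator (K n) (snd z) :: ennreal)" for n z
    have [measurable]: "K n \<in> sets borel" "E \<in> sets ?P" for n using borel_compact[OF K(1)] set by auto
    have U: "U n \<in> borel_measurable ?P" for n unfolding U_def by measurable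
    have incU: "incseq U" using K(2) by (auto simp: U_def incseq_def le_fun_def indicator_def)
    have "indicator E = (SUP n. U n)"
    proof
      fix z :: "'a set \<times> 'a"
      obtain n where n: "snd z \<in> K n" using K(3) by blast
      show "indicator E z = (SUP n. U n) z" unfolding SUP_apply
      proof (rule antisym)
        show "indicator E z \<le> (SUP n. U n z)" using n by (intro SUP_upper2[of n]) (auto simp: U_def)
      qed (auto intro!: SUP_least simp: U_def indicator_def)
    qed
    then have "L (indicator E) = (SUP n. L (U n))" "R (indicator E) = (SUP n. R (U n))"
      using L_SUP[OF U incU] R_SUP[OF U incU] by auto
    moreover have "L (U n) = R (U n)" for n
      unfolding L_def R_def U_def using mecke_sets_compact[OF K(1) set] by simp
    ultimately show ?case by simp
  next
    case (mult u c)
    have "L (\<lambda>z. c * u z) = c * L u"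
      unfolding L_def using measurable_sum_configuration[OF mult(2)] by (simp add: nn_integral_cmult)
    moreover have "R (\<lambda>z. c * u z) = (\<integral>\<^sup>+\<omega>. c * (\<integral>\<^sup>+x. u (insert x \<omega>, x) \<partial>\<sigma>) \<partial>\<pi>)"
      unfolding R_def by (intro nn_integral_cong nn_integral_cmult measurable_insert_section mult(2)) simp
    moreover have "\<dots> = c * R u"
      unfolding R_def by (intro nn_integral_cmult measurable_integral_insert mult(2))
    ultimately show ?case using mult by simp
  next
    case (add u v)
    have "L (\<lambda>z. v z + u z) = L v + L u"
      unfolding L_def using measurable_sum_configuration[OF add(1)] measurable_sum_configuration[OF add(4)]
      by (simp add: nn_integral_add)
    moreover have "R (\<lambda>z. v z + u z) = (\<integral>\<^sup>+\<omega>. (\<integral>\<^sup>+x. v (insert x \<omega>, x) \<partial>\<sigma>) + (\<integral>\<^sup>+x. u (insert x \<omega>, x) \<partial>\<sigma>) \<partial>\<pi>)"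
      unfolding R_def by (intro nn_integral_cong nn_integral_add measurable_insert_section add) simp_all
    moreover have "\<dots> = R v + R u"
      unfolding R_def by (intro nn_integral_add measurable_integral_insert add)
    ultimately show ?case using add by simp
  next
    case (seq U)
    then show ?case by (simp only: L_SUP R_SUP)
  qed
  then show ?thesis by (simp add: L_def R_def)
qed

end

subsection \<open>Partitions and injections\<close>

text \<open>Extensional functions, so that each injective family of points is counted exactly once.
  For \<open>I = {}\<close> there is one such family, which accounts for the term of the empty
  partition.\<close>

definition injections :: "'i set \<Rightarrow> 'a set \<Rightarrow> ('i \<Rightarrow> 'a) set" where
  "injections I S = {s \<in> PiE I (\<lambda>_. S). inj_on s I}"

lemma injections_empty [simp]: "injections {} S = {\<lambda>_. undefined}"
  by (auto simp: injections_def)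

lemma finite_injections: "finite I \<Longrightarrow> finite S \<Longrightarrow> finite (injections I S)"
  unfolding injections_def by (rule finite_subset[of _ "PiE I (\<lambda>_. S)"]) (auto intro: finite_PiE)

text \<open>Only values attained by \<open>f\<close> are used, which keeps every fibre nonempty as a
  block of a partition must be.\<close>

definition fibres :: "'t set \<Rightarrow> ('t \<Rightarrow> 'a) \<Rightarrow> 't set set" where
  "fibres T f = (\<lambda>x. {t \<in> T. f t = x}) ` f ` T"

lemma partition_on_fibres: "partition_on T (fibres T f)"
  by (rule partition_onI) (auto simp: fibres_def disjnt_def)

text \<open>The quotient map of the partition, meaningful for \<open>t\<close> covered by
  \<open>P\<close>.\<close>

definition block_of :: "'t set set \<Rightarrow> 't \<Rightarrow> 't set" where
  "block_of P t = (THE B. B \<in> P \<and> t \<in> B)"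

lemma block_of_eq: "partition_on T P \<Longrightarrow> B \<in> P \<Longrightarrow> t \<in> B \<Longrightarrow> block_of P t = B"
  unfolding block_of_def
  by (rule the_equality) (auto simp: partition_on_def pairwise_def disjnt_iff)

lemma block_of_mem:
  assumes "partition_on T P" "t \<in> T"
  shows "block_of P t \<in> P" "t \<in> block_of P t"
proof -
  obtain B where "B \<in> P" "t \<in> B" using partition_onD1[OF assms(1)] assms(2) by auto
  with block_of_eq[OF assms(1)] show "block_of P t \<in> P" "t \<in> block_of P t" by auto
qed

text \<open>The map \<phi> composes a labelling of the blocks with the quotient map; \<psi> recovers
  the fibres and the value on each of them. A block \<open>B\<close> labelled \<open>s B\<close>
  contributes the factor \<open>a (s B)\<close> once for each of its elements, hence the exponent
  \<open>card B\<close>.\<close>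

lemma power_sum_partitions:
  fixes a :: "'a \<Rightarrow> 'b::comm_semiring_1" and T :: "'t set"
  assumes S: "finite S" and T: "finite T"
  shows "(\<Sum>x\<in>S. a x) ^ card T =
    (\<Sum>P | partition_on T P. \<Sum>s\<in>injections P S. \<Prod>B\<in>P. a (s B) ^ card B)"
proof -
  let ?PP = "{P. partition_on T P}"
  define \<phi> where "\<phi> = (\<lambda>(P, s :: 't set \<Rightarrow> 'a). \<lambda>t\<in>T. s (block_of P t))"
  \<comment> \<open>Any representative of the block serves, since \<open>f\<close> is constant on
    its fibres.\<close>
  define \<psi> where "\<psi> f = (fibres T f, \<lambda>B\<in>fibres T f. f (SOME t. t \<in> B))" for f :: "'t \<Rightarrow> 'a"
  have finP: "finite P" if "partition_on T P" for P using finite_elements[OF T that] .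
  have some: "(SOME t. t \<in> B) \<in> B" if "B \<noteq> {}" for B :: "'t set" using that by (simp add: some_in_eq)
  have 1: "\<psi> (\<phi> (P, s)) = (P, s)" if P: "partition_on T P" and s: "s \<in> injections P S" for P s
  proof -
    let ?f = "\<phi> (P, s)"
    have f: "?f t = s (block_of P t)" if "t \<in> T" for t using that by (simp add: \<phi>_def)
    have inj: "inj_on s P" using s by (simp add: injections_def)
    \<comment> \<open>Injectivity of the labelling is used here: without it two blocks could merge
      into one fibre.\<close>
    have "{t \<in> T. ?f t = ?f t0} = block_of P t0" if t0: "t0 \<in> T" for t0
    proof (intro set_eqI iffI)
      fix t assume "t \<in> {t \<in> T. ?f t = ?f t0}"
      then have t: "t \<in> T" "s (block_of P t) = s (block_of P t0)" using t0 by (auto simp: f)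
      then have "block_of P t = block_of P t0"
        using inj_onD[OF inj] block_of_mem[OF P] t0 by blast
      then show "t \<in> block_of P t0" using block_of_mem[OF P t(1)] by simp
    next
      fix t assume t: "t \<in> block_of P t0"
      then have "t \<in> T" using block_of_mem[OF P t0] partition_onD1[OF P] by blast
      moreover have "block_of P t = block_of P t0" using block_of_eq[OF P block_of_mem(1)[OF P t0] t] .
      ultimately show "t \<in> {t \<in> T. ?f t = ?f t0}" using t0 by (simp add: f)
    qed
    then have "fibres T ?f = block_of P ` T" by (auto simp: fibres_def image_image)
    also have "\<dots> = P"
    proof (intro set_eqI iffI)
      fix B assume B: "B \<in> P"
      then have "B \<noteq> {}" using partition_onD3[OF P] by auto
      then obtain t where "t \<in> B" by blast
      then show "B \<in> block_of P ` T"
        using block_of_eq[OF P B] partition_onD1[OF P] B by (intro image_eqI[of _ _ t]) auto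
    qed (use block_of_mem[OF P] in auto)
    finally have fib: "fibres T ?f = P" .
    have "(\<lambda>B\<in>P. ?f (SOME t. t \<in> B)) = s"
    proof
      fix B show "(\<lambda>B\<in>P. ?f (SOME t. t \<in> B)) B = s B"
      proof (cases "B \<in> P")
        case True
        then have "(SOME t. t \<in> B) \<in> B" using partition_onD3[OF P] by (intro some) auto
        moreover then have "(SOME t. t \<in> B) \<in> T" using True partition_onD1[OF P] by blast
        ultimately show ?thesis using True block_of_eq[OF P True] by (simp add: f)
      next
        case False
        then show ?thesis using s by (auto simp: injections_def PiE_def extensional_def)
      qed
    qed
    then show ?thesis by (simp add: \<psi>_def fib)
  qed
  have 2: "\<phi> (\<psi> f) = f" if f: "f \<in> PiE T (\<lambda>_. S)" for f
  proof
    fix t show "\<phi> (\<psi> f) t = f t"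
    proof (cases "t \<in> T")
      case True
      let ?B = "{t' \<in> T. f t' = f t}"
      have B: "?B \<in> fibres T f" "t \<in> ?B" using True by (auto simp: fibres_def)
      have "block_of (fibres T f) t = ?B" by (rule block_of_eq[OF partition_on_fibres B])
      moreover have "(SOME t'. t' \<in> ?B) \<in> ?B" by (rule some) (use True in auto)
      ultimately show ?thesis using True B(1) by (simp add: \<phi>_def \<psi>_def)
    next
      case False
      then show ?thesis using f by (auto simp: \<phi>_def \<psi>_def PiE_def extensional_def)
    qed
  qed
  have 3: "\<phi> (P, s) \<in> PiE T (\<lambda>_. S)" if P: "partition_on T P" and s: "s \<in> injections P S" for P s
    using s block_of_mem[OF P] by (auto simp: \<phi>_def injections_def)
  have 4: "snd (\<psi> f) \<in> injections (fst (\<psi> f)) S" if f: "f \<in> PiE T (\<lambda>_. S)" for f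
  proof -
    have val: "f (SOME t. t \<in> {t \<in> T. f t = f t0}) = f t0" "(SOME t. t \<in> {t \<in> T. f t = f t0}) \<in> T" if "t0 \<in> T" for t0
      using some[of "{t \<in> T. f t = f t0}"] that by auto
    have "(\<lambda>B\<in>fibres T f. f (SOME t. t \<in> B)) \<in> fibres T f \<rightarrow>\<^sub>E S"
      using val f by (auto simp: fibres_def)
    moreover have "inj_on (\<lambda>B\<in>fibres T f. f (SOME t. t \<in> B)) (fibres T f)"
      using val by (auto simp: fibres_def inj_on_def)
    ultimately show ?thesis by (simp add: \<psi>_def injections_def)
  qed
  have 5: "(\<Prod>t\<in>T. a (\<phi> (P, s) t)) = (\<Prod>B\<in>P. a (s B) ^ card B)"
    if P: "partition_on T P" for P s
  proof -
    have "(\<Prod>t\<in>T. a (\<phi> (P, s) t)) = (\<Prod>t\<in>\<Union>P. a (s (block_of P t)))"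
      using partition_onD1[OF P] by (intro prod.cong) (auto simp: \<phi>_def)
    also have "\<dots> = (\<Prod>B\<in>P. \<Prod>t\<in>B. a (s (block_of P t)))"
      using partition_onD1[OF P] partition_onD2[OF P] T
      by (subst prod.Union_disjoint) (auto simp: disjoint_def intro: finite_subset)
    also have "\<dots> = (\<Prod>B\<in>P. a (s B) ^ card B)"
      by (intro prod.cong refl) (simp add: block_of_eq[OF P])
    finally show ?thesis .
  qed
  have "(\<Sum>x\<in>S. a x) ^ card T = (\<Prod>t\<in>T. \<Sum>x\<in>S. a x)" by simp
  also have "\<dots> = (\<Sum>f\<in>PiE T (\<lambda>_. S). \<Prod>t\<in>T. a (f t))"
    by (rule prod_sum_PiE) (use S T in auto)
  also have "\<dots> = (\<Sum>(P, s)\<in>(SIGMA P:?PP. injections P S). \<Prod>B\<in>P. a (s B) ^ card B)"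
  proof (rule sum.reindex_bij_witness[of _ \<phi> \<psi>])
    fix f assume f: "f \<in> PiE T (\<lambda>_. S)"
    show "\<phi> (\<psi> f) = f" by (rule 2[OF f])
    have *: "partition_on T (fst (\<psi> f))" by (simp add: \<psi>_def partition_on_fibres)
    then show "\<psi> f \<in> (SIGMA P:?PP. injections P S)" using 4[OF f] by (cases "\<psi> f") simp
    show "(case \<psi> f of (P, s) \<Rightarrow> \<Prod>B\<in>P. a (s B) ^ card B) = (\<Prod>t\<in>T. a (f t))"
      using 5[OF *, of "snd (\<psi> f)"] 2[OF f] by (simp add: split_beta')
  next
    fix p assume "p \<in> (SIGMA P:?PP. injections P S)"
    then obtain P s where "p = (P, s)" "partition_on T P" "s \<in> injections P S" by blast
    then show "\<psi> (\<phi> p) = p" "\<phi> p \<in> PiE T (\<lambda>_. S)" using 1 3 by simp_all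
  qed
  also have "\<dots> = (\<Sum>P\<in>?PP. \<Sum>s\<in>injections P S. \<Prod>B\<in>P. a (s B) ^ card B)"
    using finitely_many_partition_on[OF T] finite_injections[OF finP S]
    by (intro sum.Sigma[symmetric]) auto
  finally show ?thesis .
qed

subsection \<open>The multivariate Mecke formula\<close>

text \<open>The point with index \<open>i\<close> is chosen after the others and must avoid them.
  The exclusion is moved into the integrand as a zero value, so that the inner sum runs over all of
  \<open>S\<close> independently of \<open>s\<close>; this is the form to which Mecke's formula and
  the measurability results apply.\<close>

lemma nn_integral_injections_insert:
  fixes g :: "('i \<Rightarrow> 'a) \<Rightarrow> ennreal"
  assumes i: "i \<notin> I"
  shows "(\<integral>\<^sup>+s. g s \<partial>count_space (injections (insert i I) S))
    = (\<integral>\<^sup>+s. \<integral>\<^sup>+x. (if x \<in> s ` I then 0 else g (s(i := x))) \<partial>count_space S \<partial>count_space (injections I S))"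
proof -
  let ?A = "SIGMA s:injections I S. S - s ` I"
  have img: "s(i := x) ` I = s ` I" for s :: "'i \<Rightarrow> 'a" and x using i by auto
  have inj: "inj_on (s(i := x)) I \<longleftrightarrow> inj_on s I" for s :: "'i \<Rightarrow> 'a" and x
    using i by (intro inj_on_cong) auto
  have bij: "bij_betw (\<lambda>(s, x). s(i := x)) ?A (injections (insert i I) S)"
  \<comment> \<open>Resetting coordinate \<open>i\<close> to \<open>undefined\<close> keeps the
    restricted family extensional on \<open>I\<close>.\<close>
  proof (rule bij_betwI[where g="\<lambda>s. (s(i := undefined), s i)"])
    show "(\<lambda>(s, x). s(i := x)) \<in> ?A \<rightarrow> injections (insert i I) S"
      using i by (auto simp: injections_def img inj intro!: PiE_fun_upd split: if_splits)
    show "(\<lambda>s. (s(i := undefined), s i)) \<in> injections (insert i I) S \<rightarrow> ?A"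
      using i by (auto simp: injections_def img inj intro!: fun_upd_in_PiE)
    show "\<And>p. p \<in> ?A \<Longrightarrow> ((case p of (s, x) \<Rightarrow> s(i := x))(i := undefined), (case p of (s, x) \<Rightarrow> s(i := x)) i) = p"
      using i by (auto simp: injections_def PiE_def extensional_def)
  qed auto
  have "(\<integral>\<^sup>+s. g s \<partial>count_space (injections (insert i I) S))
    = (\<integral>\<^sup>+p. g ((fst p)(i := snd p)) * indicator ?A p \<partial>count_space UNIV)"
    by (subst nn_integral_bij_count_space[OF bij, symmetric])
      (simp add: split_beta' nn_integral_count_space_indicator)
  also have "\<dots> = (\<integral>\<^sup>+s. \<integral>\<^sup>+x. g (s(i := x)) * indicator ?A (s, x) \<partial>count_space UNIV \<partial>count_space UNIV)"
    by (subst nn_integral_fst_count_space[symmetric]) simp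
  also have "\<dots> = (\<integral>\<^sup>+s. (\<integral>\<^sup>+x. (if x \<in> s ` I then 0 else g (s(i := x))) * indicator S x \<partial>count_space UNIV)
      * indicator (injections I S) s \<partial>count_space UNIV)"
    by (intro nn_integral_cong, subst nn_integral_multc[symmetric])
      (auto intro!: nn_integral_cong simp: indicator_def)
  finally show ?thesis by (simp add: nn_integral_count_space_indicator)
qed

lemma measurable_eq_sigma_compact:
  assumes sc: "sigma_compact_space TYPE('a::metric_space)"
    and [measurable]: "f \<in> M \<rightarrow>\<^sub>M (borel :: 'a measure)" "g \<in> M \<rightarrow>\<^sub>M borel"
  shows "Measurable.pred M (\<lambda>z. f z = g z)"
proof -
  have "Measurable.pred (borel \<Otimes>\<^sub>M borel) (\<lambda>z::'a \<times> 'a. fst z = snd z)"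
    using diagonal_measurable[OF sc] by (simp add: pred_def space_pair_measure)
  moreover have "(\<lambda>z. (f z, g z)) \<in> M \<rightarrow>\<^sub>M (borel \<Otimes>\<^sub>M borel)" by measurable
  ultimately have "Measurable.pred M (\<lambda>z. (\<lambda>z. fst z = snd z) (f z, g z))"
    by (rule measurable_compose[rotated])
  then show ?thesis by simp
qed

text \<open>Membership of \<open>x\<close> in the finite image of \<open>s\<close> is a finite
  disjunction of equalities, each measurable through the diagonal.\<close>

lemma measurable_extend_injection:
  fixes G :: "'z \<Rightarrow> ('i \<Rightarrow> 'a::metric_space) \<Rightarrow> ennreal"
  assumes sc: "sigma_compact_space TYPE('a)" and I: "finite I"
    and G: "(\<lambda>(z, s). G z s) \<in> borel_measurable (M \<Otimes>\<^sub>M (\<Pi>\<^sub>M j\<in>insert i I. borel))"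
  shows "(\<lambda>(p, x). if x \<in> snd p ` I then 0 else G (fst p) ((snd p)(i := x)))
     \<in> borel_measurable ((M \<Otimes>\<^sub>M (\<Pi>\<^sub>M j\<in>I. borel)) \<Otimes>\<^sub>M borel)"
proof -
  let ?N = "(M \<Otimes>\<^sub>M (\<Pi>\<^sub>M j\<in>I. borel)) \<Otimes>\<^sub>M (borel :: 'a measure)"
  have mem: "Measurable.pred ?N (\<lambda>q. \<exists>j\<in>I. snd q = snd (fst q) j)"
    by (intro pred_intros_finite I measurable_eq_sigma_compact[OF sc]) measurable
  have "(\<lambda>q. (fst (fst q), (snd (fst q))(i := snd q))) \<in> ?N \<rightarrow>\<^sub>M M \<Otimes>\<^sub>M (\<Pi>\<^sub>M j\<in>insert i I. borel)"
    by measurable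
  from measurable_compose[OF this G]
  have [measurable]: "(\<lambda>q. G (fst (fst q)) ((snd (fst q))(i := snd q))) \<in> borel_measurable ?N" by simp
  have "(\<lambda>q. if \<exists>j\<in>I. snd q = snd (fst q) j then 0 else G (fst (fst q)) ((snd (fst q))(i := snd q))) \<in> borel_measurable ?N"
    using mem by measurable
  then show ?thesis by (simp add: split_beta' image_iff)
qed

text \<open>Summing out the point with index \<open>i\<close> leaves an integrand of the same kind
  on the smaller index set. In that step the remaining points act as parameters, hence the product
  of \<open>M\<close> with a space of families.\<close>

lemma measurable_nn_integral_injections:
  fixes G :: "'z \<Rightarrow> ('i \<Rightarrow> 'a::metric_space) \<Rightarrow> ennreal"
  assumes sc: "sigma_compact_space TYPE('a)" and I: "finite I"
    and h: "h \<in> M \<rightarrow>\<^sub>M configuration_space"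
    and G: "(\<lambda>(z, s). G z s) \<in> borel_measurable (M \<Otimes>\<^sub>M (\<Pi>\<^sub>M i\<in>I. borel))"
  shows "(\<lambda>z. \<integral>\<^sup>+s. G z s \<partial>count_space (injections I (h z))) \<in> borel_measurable M"
  using I G
proof (induct I arbitrary: G)
  case empty
  have "(\<lambda>z. (z, \<lambda>_. undefined)) \<in> M \<rightarrow>\<^sub>M M \<Otimes>\<^sub>M (\<Pi>\<^sub>M i\<in>{}. (borel :: 'a measure))"
    by (intro measurable_Pair) (auto simp: space_PiM)
  from measurable_compose[OF this empty] show ?case
    by (simp add: nn_integral_count_space_finite)
next
  case (insert i I)
  have "(\<lambda>p. \<integral>\<^sup>+x. (if x \<in> snd p ` I then 0 else G (fst p) ((snd p)(i := x))) \<partial>count_space (h (fst p)))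
      \<in> borel_measurable (M \<Otimes>\<^sub>M (\<Pi>\<^sub>M j\<in>I. borel))"
    by (rule measurable_nn_integral_configuration[OF sc measurable_compose[OF measurable_fst h]
          measurable_extend_injection[OF sc insert(1) insert(4)]])
  then have "(\<lambda>(z, s). \<integral>\<^sup>+x. (if x \<in> s ` I then 0 else G z (s(i := x))) \<partial>count_space (h z))
      \<in> borel_measurable (M \<Otimes>\<^sub>M (\<Pi>\<^sub>M j\<in>I. borel))"
    by (simp add: split_beta')
  from insert(3)[OF this] show ?case by (simp add: nn_integral_injections_insert[OF insert(2)])
qed

lemma measurable_union_configuration:
  fixes f :: "'i \<Rightarrow> 'z \<Rightarrow> 'a::metric_space"
  assumes sc: "sigma_compact_space TYPE('a)" and J: "finite J"
    and h: "h \<in> M \<rightarrow>\<^sub>M configuration_space" and f: "\<And>j. j \<in> J \<Longrightarrow> f j \<in> M \<rightarrow>\<^sub>M borel"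
  shows "(\<lambda>z. h z \<union> (\<lambda>j. f j z) ` J) \<in> M \<rightarrow>\<^sub>M configuration_space"
  using J f
proof (induct J)
  case (insert j J)
  then show ?case
    using measurable_insert_configuration[OF sc, of "\<lambda>z. h z \<union> (\<lambda>j. f j z) ` J" M "f j"] by simp
qed (simp add: h)

lemma measurable_add_points:
  assumes sc: "sigma_compact_space TYPE('a::metric_space)" and I: "finite I"
  shows "(\<lambda>(\<omega>, s). (\<omega> \<union> s ` I, s)) \<in> configuration_space \<Otimes>\<^sub>M (\<Pi>\<^sub>M i\<in>I. borel)
      \<rightarrow>\<^sub>M configuration_space \<Otimes>\<^sub>M (\<Pi>\<^sub>M i\<in>I. (borel :: 'a measure))"
proof -
  have "(\<lambda>p. fst p \<union> (\<lambda>i. snd p i) ` I) \<in> configuration_space \<Otimes>\<^sub>M (\<Pi>\<^sub>M i\<in>I. (borel :: 'a measure)) \<rightarrow>\<^sub>M configuration_space"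
    by (rule measurable_union_configuration[OF sc I]) measurable
  then show ?thesis by (simp add: split_beta' measurable_Pair)
qed

context poisson_space
begin

lemma sets_pi_PiM: "sets (\<pi> \<Otimes>\<^sub>M (\<Pi>\<^sub>M i\<in>I. \<sigma>)) = sets (configuration_space \<Otimes>\<^sub>M (\<Pi>\<^sub>M i\<in>I. borel))"
  by (intro sets_pair_measure_cong sets_pi sets_PiM_cong refl sets_sigma)

text \<open>The sum over the point with index \<open>i\<close> is treated as an integrand
  \<open>H\<close> for the other points, to which the induction hypothesis applies. After exchanging
  the integrals, \<open>s\<close> is fixed and the one-point formula handles the remaining
  sum.\<close>

theorem mecke_multivariate:
  fixes G :: "'a set \<Rightarrow> ('i \<Rightarrow> 'a) \<Rightarrow> ennreal"
  assumes I: "finite I" and G: "(\<lambda>(\<omega>, s). G \<omega> s) \<in> borel_measurable (configuration_space \<Otimes>\<^sub>M (\<Pi>\<^sub>M i\<in>I. borel))"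
  shows "(\<integral>\<^sup>+\<omega>. \<integral>\<^sup>+s. G \<omega> s \<partial>count_space (injections I \<omega>) \<partial>\<pi>)
    = (\<integral>\<^sup>+\<omega>. \<integral>\<^sup>+s. G (\<omega> \<union> s ` I) s \<partial>(\<Pi>\<^sub>M i\<in>I. \<sigma>) \<partial>\<pi>)"
  using I G
proof (induct I arbitrary: G)
  case empty
  interpret product_sigma_finite "\<lambda>i::'i. \<sigma>" by standard
  show ?case by (simp add: nn_integral_count_space_finite PiM_empty)
next
  case (insert i I)
  interpret product_sigma_finite "\<lambda>i::'i. \<sigma>" by standard
  interpret P: finite_product_sigma_finite "\<lambda>i::'i. \<sigma>" I by standard (rule insert(1))
  interpret pp: pair_sigma_finite \<pi> "\<Pi>\<^sub>M i\<in>I. \<sigma>" ..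
  let ?C = "configuration_space :: 'a set measure"
  let ?N = "\<Pi>\<^sub>M i\<in>I. (borel :: 'a measure)"
  let ?g = "\<lambda>\<omega> s x. if x \<in> s ` I then 0 else G \<omega> (s(i := x))"
  define H where "H \<omega> s = (\<integral>\<^sup>+x. ?g \<omega> s x \<partial>count_space \<omega>)" for \<omega> s
  define H' where "H' \<omega> s = (\<integral>\<^sup>+x. ?g (\<omega> \<union> s ` I) s x \<partial>count_space \<omega>)" for \<omega> s
  define R where "R \<omega> s = (\<integral>\<^sup>+x. G (\<omega> \<union> s(i := x) ` insert i I) (s(i := x)) \<partial>\<sigma>)" for \<omega> s
  have g: "(\<lambda>(p, x). ?g (fst p) (snd p) x) \<in> borel_measurable ((?C \<Otimes>\<^sub>M ?N) \<Otimes>\<^sub>M borel)"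
    by (rule measurable_extend_injection[OF sc insert(1) insert(4)])
  have H: "(\<lambda>(\<omega>, s). H \<omega> s) \<in> borel_measurable (?C \<Otimes>\<^sub>M ?N)"
    using measurable_nn_integral_configuration[OF sc measurable_fst g] by (simp add: H_def split_beta')
  have "(\<lambda>q. ((\<lambda>(\<omega>, s). (\<omega> \<union> s ` I, s)) (fst q), snd q)) \<in> (?C \<Otimes>\<^sub>M ?N) \<Otimes>\<^sub>M (borel :: 'a measure) \<rightarrow>\<^sub>M (?C \<Otimes>\<^sub>M ?N) \<Otimes>\<^sub>M borel"
    by (intro measurable_Pair measurable_compose[OF measurable_fst measurable_add_points[OF sc insert(1)]] measurable_snd)
  from measurable_compose[OF this g]
  have g': "(\<lambda>(p, x). ?g (fst p \<union> snd p ` I) (snd p) x) \<in> borel_measurable ((?C \<Otimes>\<^sub>M ?N) \<Otimes>\<^sub>M borel)"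
    by (simp add: split_beta' cong: if_cong)
  have H': "(\<lambda>(\<omega>, s). H' \<omega> s) \<in> borel_measurable (\<pi> \<Otimes>\<^sub>M (\<Pi>\<^sub>M i\<in>I. \<sigma>))"
    using measurable_nn_integral_configuration[OF sc measurable_fst g']
    by (simp add: H'_def split_beta' measurable_cong_sets[OF sets_pi_PiM refl])
  have H_union: "H (\<omega> \<union> s ` I) s = H' \<omega> s" for \<omega> s
    unfolding H_def H'_def by (rule nn_integral_count_space_eq) auto
  have mecke_s: "(\<integral>\<^sup>+\<omega>. H' \<omega> s \<partial>\<pi>) = (\<integral>\<^sup>+\<omega>. R \<omega> s \<partial>\<pi>)" if s: "s \<in> space (\<Pi>\<^sub>M i\<in>I. \<sigma>)" for s
  proof -
    have "s \<in> space ?N" using s by (simp add: space_PiM)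
    then have "(\<lambda>p. ((fst p, s), snd p)) \<in> ?C \<Otimes>\<^sub>M (borel :: 'a measure) \<rightarrow>\<^sub>M (?C \<Otimes>\<^sub>M ?N) \<Otimes>\<^sub>M borel"
      by measurable
    from measurable_compose[OF this g']
    have "(\<lambda>p. ?g (fst p \<union> s ` I) s (snd p)) \<in> borel_measurable (?C \<Otimes>\<^sub>M borel)"
      by (simp cong: if_cong)
    from mecke[OF this]
    have "(\<integral>\<^sup>+\<omega>. H' \<omega> s \<partial>\<pi>) = (\<integral>\<^sup>+\<omega>. \<integral>\<^sup>+x. ?g (insert x \<omega> \<union> s ` I) s x \<partial>\<sigma> \<partial>\<pi>)"
      unfolding H'_def by (simp cong: if_cong)
    also have "\<dots> = (\<integral>\<^sup>+\<omega>. R \<omega> s \<partial>\<pi>)"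
    proof (rule nn_integral_cong)
      fix \<omega>
      \<comment> \<open>Under \<sigma> the exclusion of earlier points is void almost everywhere,
        which is why no restriction on \<open>s\<close> survives on the integral side.\<close>
      have "AE x in \<sigma>. x \<notin> s ` I" using insert(1) by (intro AE_not_in_countable countable_finite) simp
      then have "AE x in \<sigma>. ?g (insert x \<omega> \<union> s ` I) s x = G (\<omega> \<union> s(i := x) ` insert i I) (s(i := x))"
      proof eventually_elim
        case (elim x)
        have "s(i := x) ` insert i I = insert x (s ` I)" using insert(2) by auto
        then show ?case using elim by simp
      qed
      then show "(\<integral>\<^sup>+x. ?g (insert x \<omega> \<union> s ` I) s x \<partial>\<sigma>) = R \<omega> s"
        unfolding R_def by (rule nn_integral_cong_AE)
    qed
    finally show ?thesis .
  qed
  have GU: "(\<lambda>p. G (fst p \<union> snd p ` insert i I) (snd p)) \<in> borel_measurable (?C \<Otimes>\<^sub>M (\<Pi>\<^sub>M i\<in>insert i I. borel))"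
    using measurable_compose[OF measurable_add_points[OF sc] insert(4)] insert(1) by (simp add: split_beta')
  have "(\<lambda>q. (fst (fst q), (snd (fst q))(i := snd q))) \<in> (?C \<Otimes>\<^sub>M ?N) \<Otimes>\<^sub>M borel \<rightarrow>\<^sub>M ?C \<Otimes>\<^sub>M (\<Pi>\<^sub>M i\<in>insert i I. (borel :: 'a measure))"
    by measurable
  from measurable_compose[OF this GU]
  have "(\<lambda>(p, x). G (fst p \<union> (snd p)(i := x) ` insert i I) ((snd p)(i := x))) \<in> borel_measurable ((?C \<Otimes>\<^sub>M ?N) \<Otimes>\<^sub>M borel)"
    by (simp add: split_beta')
  also have "borel_measurable ((?C \<Otimes>\<^sub>M ?N) \<Otimes>\<^sub>M borel) = borel_measurable ((\<pi> \<Otimes>\<^sub>M (\<Pi>\<^sub>M i\<in>I. \<sigma>)) \<Otimes>\<^sub>M \<sigma>)"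
    by (intro measurable_cong_sets refl sets_pair_measure_cong sets_pi_PiM[symmetric] sets_sigma[symmetric])
  finally have "(\<lambda>p. \<integral>\<^sup>+x. G (fst p \<union> (snd p)(i := x) ` insert i I) ((snd p)(i := x)) \<partial>\<sigma>)
      \<in> borel_measurable (\<pi> \<Otimes>\<^sub>M (\<Pi>\<^sub>M i\<in>I. \<sigma>))"
    by (rule \<sigma>.borel_measurable_nn_integral)
  then have R: "(\<lambda>(\<omega>, s). R \<omega> s) \<in> borel_measurable (\<pi> \<Otimes>\<^sub>M (\<Pi>\<^sub>M i\<in>I. \<sigma>))"
    by (simp only: R_def split_beta')
  have GS: "(\<lambda>s. G (\<omega> \<union> s ` insert i I) s) \<in> borel_measurable (\<Pi>\<^sub>M i\<in>insert i I. \<sigma>)" if "\<omega> \<in> configurations" for \<omega>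
  proof -
    have "(\<lambda>s. G (\<omega> \<union> s ` insert i I) s) \<in> borel_measurable (\<Pi>\<^sub>M i\<in>insert i I. borel)"
      using measurable_Pair2[OF GU, of \<omega>] that by simp
    moreover have "sets (\<Pi>\<^sub>M i\<in>insert i I. \<sigma>) = sets (\<Pi>\<^sub>M i\<in>insert i I. borel)"
      by (intro sets_PiM_cong refl sets_sigma)
    ultimately show ?thesis by (simp cong: measurable_cong_sets)
  qed
  have "(\<integral>\<^sup>+\<omega>. \<integral>\<^sup>+s. G \<omega> s \<partial>count_space (injections (insert i I) \<omega>) \<partial>\<pi>)
    = (\<integral>\<^sup>+\<omega>. \<integral>\<^sup>+s. H \<omega> s \<partial>count_space (injections I \<omega>) \<partial>\<pi>)"
    by (simp add: nn_integral_injections_insert[OF insert(2)] H_def)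
  also have "\<dots> = (\<integral>\<^sup>+\<omega>. \<integral>\<^sup>+s. H' \<omega> s \<partial>(\<Pi>\<^sub>M i\<in>I. \<sigma>) \<partial>\<pi>)"
    unfolding insert(3)[OF H] H_union ..
  also have "\<dots> = (\<integral>\<^sup>+s. \<integral>\<^sup>+\<omega>. H' \<omega> s \<partial>\<pi> \<partial>(\<Pi>\<^sub>M i\<in>I. \<sigma>))"
    by (rule pp.Fubini'[OF H', symmetric])
  also have "\<dots> = (\<integral>\<^sup>+s. \<integral>\<^sup>+\<omega>. R \<omega> s \<partial>\<pi> \<partial>(\<Pi>\<^sub>M i\<in>I. \<sigma>))"
    by (intro nn_integral_cong mecke_s)
  also have "\<dots> = (\<integral>\<^sup>+\<omega>. \<integral>\<^sup>+s. R \<omega> s \<partial>(\<Pi>\<^sub>M i\<in>I. \<sigma>) \<partial>\<pi>)"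
    by (rule pp.Fubini'[OF R])
  also have "\<dots> = (\<integral>\<^sup>+\<omega>. \<integral>\<^sup>+s. G (\<omega> \<union> s ` insert i I) s \<partial>(\<Pi>\<^sub>M i\<in>insert i I. \<sigma>) \<partial>\<pi>)"
    unfolding R_def by (intro nn_integral_cong product_nn_integral_insert[symmetric] insert GS) simp
  finally show ?case .
qed

end

subsection \<open>Real-valued integrands and the moment identity\<close>

text \<open>A family with a point outside \<open>K\<close> contributes zero, so a possibly infinite
  sum reduces to a finite one over points of \<open>S \<inter> K\<close> and is a real
  number.\<close>

lemma ennreal_sum_injections:
  fixes g :: "('i \<Rightarrow> 'a) \<Rightarrow> real"
  assumes I: "finite I" and S: "finite (S \<inter> K)" and nonneg: "\<And>s. 0 \<le> g s"
    and supp: "\<And>s i. i \<in> I \<Longrightarrow> s i \<notin> K \<Longrightarrow> g s = 0"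
  shows "(\<integral>\<^sup>+s. ennreal (g s) \<partial>count_space (injections I S)) = ennreal (\<Sum>s\<in>injections I (S \<inter> K). g s)"
proof -
  have "(\<integral>\<^sup>+s. ennreal (g s) \<partial>count_space (injections I S)) = (\<Sum>s\<in>injections I (S \<inter> K). ennreal (g s))"
  proof (rule nn_integral_count_space'[OF finite_injections[OF I S]])
    fix s assume "s \<in> injections I S" "s \<notin> injections I (S \<inter> K)"
    then obtain i where "i \<in> I" "s i \<notin> K" by (auto simp: injections_def PiE_def)
    then show "ennreal (g s) = 0" using supp by simp
  qed (auto simp: injections_def)
  then show ?thesis using nonneg by (simp add: sum_ennreal)
qed

context poisson_space
begin

lemma add_points_section_measurable:
  fixes G :: "'a set \<Rightarrow> ('i \<Rightarrow> 'a) \<Rightarrow> real"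
  assumes I: "finite I" and G: "(\<lambda>(\<omega>, s). G \<omega> s) \<in> borel_measurable (configuration_space \<Otimes>\<^sub>M (\<Pi>\<^sub>M i\<in>I. borel))"
  shows "(\<lambda>(\<omega>, s). G (\<omega> \<union> s ` I) s) \<in> borel_measurable (\<pi> \<Otimes>\<^sub>M (\<Pi>\<^sub>M i\<in>I. \<sigma>))"
  using measurable_compose[OF measurable_add_points[OF sc I] G]
  by (simp add: split_beta' measurable_cong_sets[OF sets_pi_PiM refl])

text \<open>The integral side is bounded uniformly in \<omega>, hence integrable, and the
  \<open>ennreal\<close> formula transfers integrability to the random sum. Integrability is
  recorded for the inner integral as well as for both outer ones, since signed integrands will be
  split at both levels.\<close>

lemma mecke_multivariate_real_nonneg:
  fixes G :: "'a set \<Rightarrow> ('i \<Rightarrow> 'a) \<Rightarrow> real"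
  assumes I: "finite I" and K: "compact K"
    and G: "(\<lambda>(\<omega>, s). G \<omega> s) \<in> borel_measurable (configuration_space \<Otimes>\<^sub>M (\<Pi>\<^sub>M i\<in>I. borel))"
    and bound: "\<And>\<omega> s. \<omega> \<in> configurations \<Longrightarrow> 0 \<le> G \<omega> s \<and> G \<omega> s \<le> c"
    and supp: "\<And>\<omega> s i. \<omega> \<in> configurations \<Longrightarrow> i \<in> I \<Longrightarrow> s i \<notin> K \<Longrightarrow> G \<omega> s = 0"
  shows "integrable \<pi> (\<lambda>\<omega>. \<Sum>s\<in>injections I (\<omega> \<inter> K). G \<omega> s)"
    and "\<omega> \<in> configurations \<Longrightarrow> integrable (\<Pi>\<^sub>M i\<in>I. \<sigma>) (\<lambda>s. G (\<omega> \<union> s ` I) s)"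
    and "integrable \<pi> (\<lambda>\<omega>. \<integral>s. G (\<omega> \<union> s ` I) s \<partial>(\<Pi>\<^sub>M i\<in>I. \<sigma>))"
    and "(\<integral>\<omega>. (\<Sum>s\<in>injections I (\<omega> \<inter> K). G \<omega> s) \<partial>\<pi>) = (\<integral>\<omega>. \<integral>s. G (\<omega> \<union> s ` I) s \<partial>(\<Pi>\<^sub>M i\<in>I. \<sigma>) \<partial>\<pi>)"
proof -
  interpret product_sigma_finite "\<lambda>i::'i. \<sigma>" by standard
  interpret P: finite_product_sigma_finite "\<lambda>i::'i. \<sigma>" I by standard (rule I)
  let ?N = "\<Pi>\<^sub>M i\<in>I. \<sigma>"
  define L where "L \<omega> = (\<Sum>s\<in>injections I (\<omega> \<inter> K). G \<omega> s)" for \<omega>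
  define R where "R \<omega> = (\<integral>s. G (\<omega> \<union> s ` I) s \<partial>?N)" for \<omega>
  define b where "b = ennreal c * emeasure \<sigma> K ^ card I"
  have b: "b < \<infinity>"
    using finite_on_compact[OF K] by (simp add: b_def ennreal_mult_less_top power_less_top_ennreal)
  have union: "\<omega> \<union> s ` I \<in> configurations" if "\<omega> \<in> configurations" for \<omega> s
    using that I by (intro configurations_Un) auto
  have Gm: "(\<lambda>(\<omega>, s). G (\<omega> \<union> s ` I) s) \<in> borel_measurable (\<pi> \<Otimes>\<^sub>M ?N)"
    by (rule add_points_section_measurable[OF I G])
  have Gs: "(\<lambda>s. G (\<omega> \<union> s ` I) s) \<in> borel_measurable ?N" if "\<omega> \<in> configurations" for \<omega>
    using measurable_Pair2[OF Gm, of \<omega>] that by simp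
  have indK: "indicator K \<in> borel_measurable \<sigma>"
    using borel_compact[OF K] by (intro borel_measurable_indicator) (simp add: sets_sigma)
  have le_b: "(\<integral>\<^sup>+s. ennreal (G (\<omega> \<union> s ` I) s) \<partial>?N) \<le> b" if w: "\<omega> \<in> configurations" for \<omega>
  proof -
    have "(\<integral>\<^sup>+s. ennreal (G (\<omega> \<union> s ` I) s) \<partial>?N) \<le> (\<integral>\<^sup>+s. ennreal c * (\<Prod>i\<in>I. indicator K (s i)) \<partial>?N)"
    proof (rule nn_integral_mono)
      fix s
      show "ennreal (G (\<omega> \<union> s ` I) s) \<le> ennreal c * (\<Prod>i\<in>I. indicator K (s i))"
      proof (cases "\<forall>i\<in>I. s i \<in> K")
        case True
        then show ?thesis using bound[OF union[OF w]] by (simp add: ennreal_leI)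
      next
        case False
        then show ?thesis using supp[OF union[OF w]] by auto
      qed
    qed
    also have "\<dots> = ennreal c * (\<integral>\<^sup>+s. (\<Prod>i\<in>I. indicator K (s i)) \<partial>?N)"
      by (intro nn_integral_cmult borel_measurable_prod_ennreal measurable_compose[OF _ indK] measurable_component_singleton)
    also have "(\<integral>\<^sup>+s. (\<Prod>i\<in>I. indicator K (s i)) \<partial>?N) = (\<Prod>i\<in>I. \<integral>\<^sup>+x. indicator K x \<partial>\<sigma>)"
      by (intro product_nn_integral_prod I indK)
    also have "\<dots> = emeasure \<sigma> K ^ card I" using borel_compact[OF K] by (simp add: sets_sigma)
    finally show ?thesis by (simp add: b_def)
  qed
  show intR: "integrable ?N (\<lambda>s. G (\<omega> \<union> s ` I) s)" if "\<omega> \<in> configurations" for \<omega>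
    using bound[OF union[OF that]] le_b[OF that] b
    by (intro integrableI_nonneg Gs that) (auto intro: order_le_less_trans)
  have R: "ennreal (R \<omega>) = (\<integral>\<^sup>+s. ennreal (G (\<omega> \<union> s ` I) s) \<partial>?N)" if "\<omega> \<in> configurations" for \<omega>
    unfolding R_def using bound[OF union[OF that]] intR[OF that] by (intro nn_integral_eq_integral[symmetric]) auto
  have L: "ennreal (L \<omega>) = (\<integral>\<^sup>+s. ennreal (G \<omega> s) \<partial>count_space (injections I \<omega>))" if "\<omega> \<in> configurations" for \<omega>
    unfolding L_def using bound[OF that] supp[OF that] configurations_finite_Int[OF that K]
    by (intro ennreal_sum_injections[symmetric] I) auto
  have L0: "0 \<le> L \<omega>" if "\<omega> \<in> configurations" for \<omega>
    unfolding L_def using bound[OF that] by (intro sum_nonneg) auto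
  have R0: "0 \<le> R \<omega>" if "\<omega> \<in> configurations" for \<omega>
    unfolding R_def using bound[OF union[OF that]] by (intro Bochner_Integration.integral_nonneg) auto
  have Rm: "R \<in> borel_measurable \<pi>"
    unfolding R_def using P.borel_measurable_lebesgue_integral[OF Gm] by simp
  have Ge: "(\<lambda>(\<omega>, s). ennreal (G \<omega> s)) \<in> borel_measurable (configuration_space \<Otimes>\<^sub>M (\<Pi>\<^sub>M i\<in>I. borel))"
    using measurable_compose[OF G measurable_ennreal] by (simp add: split_beta')
  have "(\<lambda>\<omega>. \<integral>\<^sup>+s. ennreal (G \<omega> s) \<partial>count_space (injections I \<omega>)) \<in> borel_measurable configuration_space"
    by (rule measurable_nn_integral_injections[OF sc I _ Ge]) simp
  then have "(\<lambda>\<omega>. \<integral>\<^sup>+s. ennreal (G \<omega> s) \<partial>count_space (injections I \<omega>)) \<in> borel_measurable \<pi>"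
    by (simp cong: measurable_cong_sets add: sets_pi)
  \<comment> \<open>The sum \<open>L\<close> ranges over a set that varies with \<omega>; its
    measurability is inherited from the counting integral with which it agrees.\<close>
  then have "(\<lambda>\<omega>. enn2real (\<integral>\<^sup>+s. ennreal (G \<omega> s) \<partial>count_space (injections I \<omega>))) \<in> borel_measurable \<pi>"
    by (rule borel_measurable_enn2real)
  then have Lm: "L \<in> borel_measurable \<pi>"
    by (rule measurable_cong[THEN iffD1, rotated]) (simp add: L[symmetric] L0)
  have eq: "(\<integral>\<^sup>+\<omega>. ennreal (L \<omega>) \<partial>\<pi>) = (\<integral>\<^sup>+\<omega>. ennreal (R \<omega>) \<partial>\<pi>)"
  proof -
    have "(\<integral>\<^sup>+\<omega>. ennreal (L \<omega>) \<partial>\<pi>) = (\<integral>\<^sup>+\<omega>. \<integral>\<^sup>+s. ennreal (G \<omega> s) \<partial>count_space (injections I \<omega>) \<partial>\<pi>)"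
      using L by (intro nn_integral_cong) simp
    also have "\<dots> = (\<integral>\<^sup>+\<omega>. \<integral>\<^sup>+s. ennreal (G (\<omega> \<union> s ` I) s) \<partial>?N \<partial>\<pi>)"
      by (rule mecke_multivariate[OF I Ge])
    also have "\<dots> = (\<integral>\<^sup>+\<omega>. ennreal (R \<omega>) \<partial>\<pi>)"
      using R by (intro nn_integral_cong) simp
    finally show ?thesis .
  qed
  have "(\<integral>\<^sup>+\<omega>. ennreal (R \<omega>) \<partial>\<pi>) \<le> (\<integral>\<^sup>+\<omega>. b \<partial>\<pi>)"
    using R le_b by (intro nn_integral_mono) simp
  also have "\<dots> < \<infinity>" using b emeasure_space_1 by simp
  finally have fin: "(\<integral>\<^sup>+\<omega>. ennreal (R \<omega>) \<partial>\<pi>) < \<infinity>" .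
  show "integrable \<pi> (\<lambda>\<omega>. \<Sum>s\<in>injections I (\<omega> \<inter> K). G \<omega> s)"
    unfolding L_def[symmetric] using fin L0 by (intro integrableI_nonneg Lm) (auto simp: eq)
  show "integrable \<pi> (\<lambda>\<omega>. \<integral>s. G (\<omega> \<union> s ` I) s \<partial>?N)"
    unfolding R_def[symmetric] using fin R0 by (intro integrableI_nonneg Rm) auto
  have "(\<integral>\<omega>. L \<omega> \<partial>\<pi>) = (\<integral>\<omega>. R \<omega> \<partial>\<pi>)"
    using integral_eq_nn_integral[OF Lm AE_I2] integral_eq_nn_integral[OF Rm AE_I2] L0 R0 eq by simp
  then show "(\<integral>\<omega>. (\<Sum>s\<in>injections I (\<omega> \<inter> K). G \<omega> s) \<partial>\<pi>) = (\<integral>\<omega>. \<integral>s. G (\<omega> \<union> s ` I) s \<partial>?N \<partial>\<pi>)"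
    by (simp add: L_def R_def)
qed

text \<open>Split into positive and negative parts; each inherits measurability, the bound and the
  support condition.\<close>

lemma mecke_multivariate_real:
  fixes G :: "'a set \<Rightarrow> ('i \<Rightarrow> 'a) \<Rightarrow> real"
  assumes I: "finite I" and K: "compact K"
    and G: "(\<lambda>(\<omega>, s). G \<omega> s) \<in> borel_measurable (configuration_space \<Otimes>\<^sub>M (\<Pi>\<^sub>M i\<in>I. borel))"
    and bound: "\<And>\<omega> s. \<omega> \<in> configurations \<Longrightarrow> \<bar>G \<omega> s\<bar> \<le> c"
    and supp: "\<And>\<omega> s i. \<omega> \<in> configurations \<Longrightarrow> i \<in> I \<Longrightarrow> s i \<notin> K \<Longrightarrow> G \<omega> s = 0"
  shows "integrable \<pi> (\<lambda>\<omega>. \<Sum>s\<in>injections I (\<omega> \<inter> K). G \<omega> s)" (is ?int)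
    and "(\<integral>\<omega>. (\<Sum>s\<in>injections I (\<omega> \<inter> K). G \<omega> s) \<partial>\<pi>) = (\<integral>\<omega>. \<integral>s. G (\<omega> \<union> s ` I) s \<partial>(\<Pi>\<^sub>M i\<in>I. \<sigma>) \<partial>\<pi>)" (is ?eq)
proof -
  let ?N = "\<Pi>\<^sub>M i\<in>I. \<sigma>"
  define Gp where "Gp \<omega> s = max 0 (G \<omega> s)" for \<omega> s
  define Gn where "Gn \<omega> s = max 0 (- G \<omega> s)" for \<omega> s
  have diff: "G \<omega> s = Gp \<omega> s - Gn \<omega> s" for \<omega> s by (simp add: Gp_def Gn_def max_def)
  have G': "(\<lambda>z. G (fst z) (snd z)) \<in> borel_measurable (configuration_space \<Otimes>\<^sub>M (\<Pi>\<^sub>M i\<in>I. borel))"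
    using G by (simp add: split_beta')
  have Gp: "(\<lambda>(\<omega>, s). Gp \<omega> s) \<in> borel_measurable (configuration_space \<Otimes>\<^sub>M (\<Pi>\<^sub>M i\<in>I. borel))"
    unfolding Gp_def split_beta' using G' by measurable
  have Gn: "(\<lambda>(\<omega>, s). Gn \<omega> s) \<in> borel_measurable (configuration_space \<Otimes>\<^sub>M (\<Pi>\<^sub>M i\<in>I. borel))"
    unfolding Gn_def split_beta' using G' by measurable
  have bp: "0 \<le> Gp \<omega> s \<and> Gp \<omega> s \<le> c" and bn: "0 \<le> Gn \<omega> s \<and> Gn \<omega> s \<le> c" if "\<omega> \<in> configurations" for \<omega> s
    using bound[OF that, of s] by (auto simp: Gp_def Gn_def)
  have sp: "Gp \<omega> s = 0" and sn: "Gn \<omega> s = 0" if "\<omega> \<in> configurations" "i \<in> I" "s i \<notin> K" for \<omega> s i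
    using supp[of \<omega> i s] that by (auto simp: Gp_def Gn_def)
  note p = mecke_multivariate_real_nonneg[OF I K Gp bp sp]
  note n = mecke_multivariate_real_nonneg[OF I K Gn bn sn]
  have sum: "(\<Sum>s\<in>injections I (\<omega> \<inter> K). G \<omega> s)
    = (\<Sum>s\<in>injections I (\<omega> \<inter> K). Gp \<omega> s) - (\<Sum>s\<in>injections I (\<omega> \<inter> K). Gn \<omega> s)" for \<omega>
    by (simp add: diff sum_subtractf)
  show ?int unfolding sum by (rule Bochner_Integration.integrable_diff[OF p(1) n(1)])
  have "(\<integral>\<omega>. (\<Sum>s\<in>injections I (\<omega> \<inter> K). G \<omega> s) \<partial>\<pi>)
    = (\<integral>\<omega>. (\<Sum>s\<in>injections I (\<omega> \<inter> K). Gp \<omega> s) \<partial>\<pi>) - (\<integral>\<omega>. (\<Sum>s\<in>injections I (\<omega> \<inter> K). Gn \<omega> s) \<partial>\<pi>)"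
    unfolding sum by (rule Bochner_Integration.integral_diff[OF p(1) n(1)])
  also have "\<dots> = (\<integral>\<omega>. \<integral>s. Gp (\<omega> \<union> s ` I) s \<partial>?N \<partial>\<pi>) - (\<integral>\<omega>. \<integral>s. Gn (\<omega> \<union> s ` I) s \<partial>?N \<partial>\<pi>)"
    by (intro arg_cong2[where f="(-)"] p(4) n(4))
  also have "\<dots> = (\<integral>\<omega>. (\<integral>s. Gp (\<omega> \<union> s ` I) s \<partial>?N) - (\<integral>s. Gn (\<omega> \<union> s ` I) s \<partial>?N) \<partial>\<pi>)"
    by (rule Bochner_Integration.integral_diff[symmetric, OF p(3) n(3)])
  also have "\<dots> = (\<integral>\<omega>. \<integral>s. G (\<omega> \<union> s ` I) s \<partial>?N \<partial>\<pi>)"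
    unfolding diff
    by (intro Bochner_Integration.integral_cong refl Bochner_Integration.integral_diff[symmetric] p(2) n(2)) simp_all
  finally show ?eq .
qed

text \<open>The partition expansion turns the power into sums over injective labellings by points of
  \<omega> in \<open>K\<close>. The multivariate formula applies to each partition with its blocks
  as index set.\<close>

lemma moment_identity:
  fixes F :: "'a set \<Rightarrow> real" and u :: "'a set \<Rightarrow> 'a \<Rightarrow> real"
  assumes F: "F \<in> borel_measurable configuration_space"
    and Fb: "\<And>\<omega>. \<omega> \<in> configurations \<Longrightarrow> \<bar>F \<omega>\<bar> \<le> c"
    and u: "(\<lambda>(\<omega>, x). u \<omega> x) \<in> borel_measurable (configuration_space \<Otimes>\<^sub>M borel)"
    and ub: "\<And>\<omega> x. \<omega> \<in> configurations \<Longrightarrow> \<bar>u \<omega> x\<bar> \<le> d"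
    and K: "compact K" and uK: "\<And>\<omega> x. \<omega> \<in> configurations \<Longrightarrow> x \<notin> K \<Longrightarrow> u \<omega> x = 0"
    and T: "finite T"
  shows "(\<integral>\<omega>. F \<omega> * (\<integral>x. u \<omega> x \<partial>point_measure_of \<omega>) ^ card T \<partial>\<pi>) =
    (\<Sum>P | partition_on T P.
       \<integral>\<omega>. (\<integral>s. F (\<omega> \<union> s ` P) * (\<Prod>B\<in>P. u (\<omega> \<union> s ` P) (s B) ^ card B) \<partial>(\<Pi>\<^sub>M B\<in>P. \<sigma>)) \<partial>\<pi>)"
proof -
  define G where "G P \<omega> s = F \<omega> * (\<Prod>B\<in>P. u \<omega> (s B) ^ card B)" for P :: "'b set set" and \<omega> s
  \<comment> \<open>Compact support turns the integral against the point measure into a finite sum,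
    as the partition expansion requires.\<close>
  have int_u: "(\<integral>x. u \<omega> x \<partial>point_measure_of \<omega>) = (\<Sum>x\<in>\<omega> \<inter> K. u \<omega> x)" if w: "\<omega> \<in> configurations" for \<omega>
  proof -
    have [measurable]: "u \<omega> \<in> borel_measurable borel" using measurable_Pair2[OF u, of \<omega>] w by simp
    have "(\<integral>x. u \<omega> x \<partial>point_measure_of \<omega>) = (\<integral>x. u \<omega> x \<partial>count_space \<omega>)"
      unfolding point_measure_of_def by (subst integral_distr) auto
    also have "\<dots> = (\<Sum>x | x \<in> \<omega> \<and> u \<omega> x \<noteq> 0. u \<omega> x)"
      using configurations_finite_Int[OF w K] uK[OF w]
      by (intro lebesgue_integral_count_space_finite_support) (auto elim!: finite_subset[rotated])
    also have "\<dots> = (\<Sum>x\<in>\<omega> \<inter> K. u \<omega> x)"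
      using configurations_finite_Int[OF w K] uK[OF w] by (intro sum.mono_neutral_left) auto
    finally show ?thesis .
  qed
  have mecke_G: "integrable \<pi> (\<lambda>\<omega>. \<Sum>s\<in>injections P (\<omega> \<inter> K). G P \<omega> s)"
      "(\<integral>\<omega>. (\<Sum>s\<in>injections P (\<omega> \<inter> K). G P \<omega> s) \<partial>\<pi>)
        = (\<integral>\<omega>. \<integral>s. G P (\<omega> \<union> s ` P) s \<partial>(\<Pi>\<^sub>M B\<in>P. \<sigma>) \<partial>\<pi>)"
    if P: "partition_on T P" for P
  proof -
    have finP: "finite P" by (rule finite_elements[OF T P])
    \<comment> \<open>Blocks are nonempty, so a vanishing \<open>u\<close> makes its power vanish;
      with exponent 0 the convention \<open>0^0 = 1\<close> would break the support
      condition.\<close>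
    have card_B: "card B \<noteq> 0" if "B \<in> P" for B
    proof -
      have "B \<subseteq> T" "B \<noteq> {}" using that partition_onD1[OF P] partition_onD3[OF P] by auto
      then show ?thesis using finite_subset[OF _ T] by (simp add: card_eq_0_iff)
    qed
    have meas: "(\<lambda>(\<omega>, s). G P \<omega> s) \<in> borel_measurable (configuration_space \<Otimes>\<^sub>M (\<Pi>\<^sub>M B\<in>P. borel))"
    proof -
      let ?M = "configuration_space \<Otimes>\<^sub>M (\<Pi>\<^sub>M B\<in>P. (borel :: 'a measure))"
      have "(\<lambda>z. u (fst z) (snd z B)) \<in> borel_measurable ?M" if [simp]: "B \<in> P" for B
      proof -
        have "(\<lambda>z. (fst z, snd z B)) \<in> ?M \<rightarrow>\<^sub>M configuration_space \<Otimes>\<^sub>M borel" by measurable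
        from measurable_compose[OF this u] show ?thesis by simp
      qed
      then have "(\<lambda>z. \<Prod>B\<in>P. u (fst z) (snd z B) ^ card B) \<in> borel_measurable ?M"
        by (intro borel_measurable_prod borel_measurable_power)
      moreover have "(\<lambda>z. F (fst z)) \<in> borel_measurable ?M"
        by (rule measurable_compose[OF measurable_fst F])
      ultimately show ?thesis unfolding G_def split_beta' by (rule borel_measurable_times[rotated])
    qed
    \<comment> \<open>The absolute values of \<open>c\<close> and \<open>d\<close> make the bounds
      visibly nonnegative, as monotonicity of products requires.\<close>
    have bound: "\<bar>G P \<omega> s\<bar> \<le> \<bar>c\<bar> * (\<Prod>B\<in>P. \<bar>d\<bar> ^ card B)" if w: "\<omega> \<in> configurations" for \<omega> s
      unfolding G_def abs_mult abs_prod power_abs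
      using Fb[OF w] ub[OF w]
      by (intro mult_mono prod_mono conjI power_mono prod_nonneg) (auto intro: order_trans[OF _ abs_ge_self])
    have supp: "G P \<omega> s = 0" if "\<omega> \<in> configurations" "B \<in> P" "s B \<notin> K" for \<omega> s B
    proof -
      have "u \<omega> (s B) ^ card B = 0" using uK[OF that(1,3)] card_B[OF that(2)] by simp
      then have "(\<Prod>B\<in>P. u \<omega> (s B) ^ card B) = 0" using finP that(2) by (auto intro: prod_zero)
      then show ?thesis by (simp add: G_def)
    qed
    show "integrable \<pi> (\<lambda>\<omega>. \<Sum>s\<in>injections P (\<omega> \<inter> K). G P \<omega> s)"
      by (rule mecke_multivariate_real(1)[OF finP K meas bound supp])
    show "(\<integral>\<omega>. (\<Sum>s\<in>injections P (\<omega> \<inter> K). G P \<omega> s) \<partial>\<pi>)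
        = (\<integral>\<omega>. \<integral>s. G P (\<omega> \<union> s ` P) s \<partial>(\<Pi>\<^sub>M B\<in>P. \<sigma>) \<partial>\<pi>)"
      by (rule mecke_multivariate_real(2)[OF finP K meas bound supp])
  qed
  have "(\<integral>\<omega>. F \<omega> * (\<integral>x. u \<omega> x \<partial>point_measure_of \<omega>) ^ card T \<partial>\<pi>)
    = (\<integral>\<omega>. (\<Sum>P | partition_on T P. \<Sum>s\<in>injections P (\<omega> \<inter> K). G P \<omega> s) \<partial>\<pi>)"
  proof (rule Bochner_Integration.integral_cong[OF refl])
    fix \<omega> assume "\<omega> \<in> space \<pi>"
    then have w: "\<omega> \<in> configurations" by simp
    show "F \<omega> * (\<integral>x. u \<omega> x \<partial>point_measure_of \<omega>) ^ card T
      = (\<Sum>P | partition_on T P. \<Sum>s\<in>injections P (\<omega> \<inter> K). G P \<omega> s)"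
      unfolding int_u[OF w] G_def power_sum_partitions[OF configurations_finite_Int[OF w K] T]
      by (simp add: sum_distrib_left)
  qed
  also have "\<dots> = (\<Sum>P | partition_on T P. \<integral>\<omega>. (\<Sum>s\<in>injections P (\<omega> \<inter> K). G P \<omega> s) \<partial>\<pi>)"
    using mecke_G(1) by (intro Bochner_Integration.integral_sum) auto
  also have "\<dots> = (\<Sum>P | partition_on T P. \<integral>\<omega>. \<integral>s. G P (\<omega> \<union> s ` P) s \<partial>(\<Pi>\<^sub>M B\<in>P. \<sigma>) \<partial>\<pi>)"
    using mecke_G(2) by (intro sum.cong) auto
  finally show ?thesis by (simp only: G_def)
qed

end

text \<open>The space \<open>X^k\<close> appears as functions on the set \<open>P\<close> of blocks
  with the product measure over \<open>P\<close>, so the point attached to block \<open>B\<close> is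
  \<open>s B\<close> and its exponent is \<open>card B\<close>. For \<open>n = 0\<close> the index
  set \<open>{1..n}\<close> is empty and its only partition is \<open>{}\<close>.\<close>

theorem proposition3p1:
  fixes \<sigma> :: "'a::metric_space measure"
    and \<pi> :: "'a set measure"
    and F :: "'a set \<Rightarrow> real"
    and u :: "'a set \<Rightarrow> 'a \<Rightarrow> real"
    and n :: nat
  assumes "sigma_compact_space TYPE('a)"
    and "sets \<sigma> = sets borel"
    and "sigma_finite_measure \<sigma>"
    and "diffuse \<sigma>"
    and "\<And>K. compact K \<Longrightarrow> emeasure \<sigma> K < \<infinity>"
    and "poisson_measure \<sigma> \<pi>"
    and "F \<in> borel_measurable configuration_space"
    and "\<exists>C. \<forall>\<omega>\<in>configurations. \<bar>F \<omega>\<bar> \<le> C"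
    and "(\<lambda>(\<omega>, x). u \<omega> x) \<in> borel_measurable (configuration_space \<Otimes>\<^sub>M borel)"
    and "bounded_process u"
    and "compactly_supported_process u"
  shows "(\<integral>\<omega>. F \<omega> * (\<integral>x. u \<omega> x \<partial>point_measure_of \<omega>) ^ n \<partial>\<pi>) =
    (\<Sum>P | partition_on {1..n} P.
       \<integral>\<omega>. (\<integral>s. add_points P s (\<lambda>\<eta>. F \<eta> * (\<Prod>B\<in>P. u \<eta> (s B) ^ card B)) \<omega>
              \<partial>(\<Pi>\<^sub>M B\<in>P. \<sigma>)) \<partial>\<pi>)"
proof -
  interpret poisson_space \<sigma> \<pi>
    using assms(1-6) by (rule poisson_space.intro)
  obtain c where c: "\<And>\<omega>. \<omega> \<in> configurations \<Longrightarrow> \<bar>F \<omega>\<bar> \<le> c"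
    using assms(8) by auto
  obtain d where d: "\<And>\<omega> x. \<omega> \<in> configurations \<Longrightarrow> \<bar>u \<omega> x\<bar> \<le> d"
    using assms(10) by (auto simp: bounded_process_def)
  obtain K where K: "compact K" "\<And>\<omega> x. \<omega> \<in> configurations \<Longrightarrow> x \<notin> K \<Longrightarrow> u \<omega> x = 0"
    using assms(11) by (auto simp: compactly_supported_process_def)
  show ?thesis
    using moment_identity[OF assms(7) c assms(9) d K finite_atLeastAtMost, of 1 n]
    by (simp add: add_points_def)
qed

end
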